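(* Let $\Gamma=\Gamma(B)$ be the quiver of a cluster-tilted algebra of simply-laced Dynkin type $\Delta$, let $k$ be a vertex of $\Gamma$, and let $\Gamma'=\Gamma(B')$ be the quiver obtained from $\Gamma$ by mutating at $k$, with vertex set $\Gamma_0'$ identified with $\Gamma_0$. Let $\{\gamma_x : x\in\Gamma_0\}\subseteq\Phi$ be a companion basis for $\Gamma$. Then: (i) the set $\{\gamma_x' : x\in\Gamma_0'\}\subseteq\Phi$ given by $\gamma_x'=s_{\gamma_k}(\gamma_x)$ if there is an arrow from $x$ to $k$ in $\Gamma$, and $\gamma_x'=\gamma_x$ otherwise, is a companion basis for $\Gamma'$; (ii) the set $\{\gamma_x'' : x\in\Gamma_0'\}\subseteq\Phi$ given by $\gamma_x''=s_{\gamma_k}(\gamma_x)$ if there is an arrow from $k$ to $x$ in $\Gamma$, and $\gamma_x''=\gamma_x$ otherwise, is a companion basis for $\Gamma'$.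
   Context: Let $\Delta$ be a Dynkin diagram of type $A_n$, $D_n$, $E_6$, $E_7$ or $E_8$, with $n$ vertices. For a skew-symmetric integer matrix $B=(b_{xy})$ and an index $k$, the mutation of $B$ at $k$ is $B'=(b'_{xy})$ with $b'_{xy}=-b_{xy}$ if $x=k$ or $y=k$, and $b'_{xy}=b_{xy}+\frac{|b_{xk}|b_{ky}+b_{xk}|b_{ky}|}{2}$ otherwise; mutation equivalence means being connected by finitely many mutations. The Cartan counterpart of $B$ has diagonal entries $2$ and off-diagonal entries $-|b_{xy}|$. Fix a skew-symmetric integer matrix $B$, with rows and columns indexed by an $n$-element set $\Gamma_0$, which is an exchange matrix of the cluster algebra of type $\Delta$, i.e. $B$ is mutation equivalent to a matrix $B_0$ whose Cartan counterpart is the Cartan matrix of type $\Delta$. (All entries of $B$ then lie in $\{0,\pm1\}$.) Let $\Gamma=\Gamma(B)$ be the quiver with vertex set $\Gamma_0$ and an arrow $x\to y$ whenever $b_{xy}>0$; these are exactly the quivers of the cluster-tilted algebras of type $\Delta$. The quiver obtained from $\Gamma$ by mutating at $k$ is $\Gamma'=\Gamma(B')$, where $B'$ is the mutation of $B$ at $k$. Let $V$ be a Euclidean space with positive definite symmetric bilinear form $(\;,\;)$, and let $\Phi\subseteq V$ be the root system of type $\Delta$ (spanning $V$), normalised so that $(\alpha,\alpha)=2$ for every root. For a root $\gamma$, $s_\gamma(v)=v-(v,\gamma)\gamma$ is the corresponding reflection. A quasi-Cartan companion of a skew-symmetric integer matrix $B$ is a (here symmetric) integer matrix $A=(a_{xy})$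 with $a_{xx}=2$ for all $x$ and $|a_{xy}|=|b_{xy}|$ for all $x\ne y$; it is positive if it is positive definite. A companion basis for $\Gamma(B)$ is a subset $\{\gamma_x:x\in\Gamma_0\}\subseteq\Phi$, indexed by the vertices, which is a $\mathbb Z$-basis of $\mathbb Z\Phi$ and is such that the matrix $A=(a_{xy})$ with $a_{xy}=(\gamma_x,\gamma_y)$ is a positive quasi-Cartan companion of $B$. Terminology: the companion basis in (i) is said to be obtained from $\{\gamma_x\}$ by mutating inwardly at $k$, and that in (ii) by mutating outwardly at $k$. *)

theory Defs
  imports "HOL-Analysis.Analysis"
begin

section \<open>Simply-laced Dynkin diagrams\<close>

datatype dynkin = Dynkin_A nat | Dynkin_D nat | Dynkin_E nat

fun dynkin_ok :: "dynkin \<Rightarrow> bool" where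
  "dynkin_ok (Dynkin_A n) \<longleftrightarrow> n \<ge> 1"
| "dynkin_ok (Dynkin_D n) \<longleftrightarrow> n \<ge> 4"
| "dynkin_ok (Dynkin_E n) \<longleftrightarrow> n \<in> {6, 7, 8}"

fun dynkin_rank :: "dynkin \<Rightarrow> nat" where
  "dynkin_rank (Dynkin_A n) = n"
| "dynkin_rank (Dynkin_D n) = n"
| "dynkin_rank (Dynkin_E n) = n"

definition dynkin_vertices :: "dynkin \<Rightarrow> nat set" where
  "dynkin_vertices \<Delta> = {1..dynkin_rank \<Delta>}"

text \<open>Bourbaki labelling of the vertices; each edge is listed once, as a pair \<open>i < j\<close>.\<close>

fun dynkin_edge :: "dynkin \<Rightarrow> nat \<Rightarrow> nat \<Rightarrow> bool" where
  "dynkin_edge (Dynkin_A n) i j \<longleftrightarrow> 1 \<le> i \<and> j = i + 1 \<and> j \<le> n"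
| "dynkin_edge (Dynkin_D n) i j \<longleftrightarrow>
     1 \<le> i \<and> j = i + 1 \<and> j \<le> n - 1 \<or> i = n - 2 \<and> j = n"
| "dynkin_edge (Dynkin_E n) i j \<longleftrightarrow>
     i = 1 \<and> j = 3 \<or> i = 2 \<and> j = 4 \<or> 3 \<le> i \<and> j = i + 1 \<and> j \<le> n"

definition cartan_matrix :: "dynkin \<Rightarrow> nat \<Rightarrow> nat \<Rightarrow> int" where
  "cartan_matrix \<Delta> i j =
     (if i = j then 2 else if dynkin_edge \<Delta> i j \<or> dynkin_edge \<Delta> j i then -1 else 0)"


section \<open>Exchange matrices, mutation and quivers\<close>

definition skew_symmetric :: "int^'i^'i \<Rightarrow> bool" where
  "skew_symmetric B \<longleftrightarrow> transpose B = - B"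

text \<open>The integer division by 2 is exact: \<open>\<bar>a\<bar> * b + a * \<bar>b\<bar>\<close> is \<open>0\<close> or \<open>\<plusminus> 2 * a * b\<close>.\<close>

definition mutate :: "'i \<Rightarrow> int^'i^'i \<Rightarrow> int^'i^'i" where
  "mutate k B = (\<chi> x y. if x = k \<or> y = k then - B$x$y
     else B$x$y + (\<bar>B$x$k\<bar> * B$k$y + B$x$k * \<bar>B$k$y\<bar>) div 2)"

text \<open>On skew-symmetric matrices each mutation is an involution, so there the reflexive
  transitive closure is already symmetric.\<close>

definition mutation_equivalent :: "int^'i^'i \<Rightarrow> int^'i^'i \<Rightarrow> bool" where
  "mutation_equivalent = (\<lambda>B B'. \<exists>k. B' = mutate k B)\<^sup>*\<^sup>*"

definition cartan_counterpart :: "int^'i^'i \<Rightarrow> int^'i^'i" where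
  "cartan_counterpart B = (\<chi> x y. if x = y then 2 else - \<bar>B$x$y\<bar>)"

text \<open>The bijection \<open>\<sigma>\<close> labels the index set by the vertices of the Dynkin diagram; in
  particular the number of indices is the rank.\<close>

definition exchange_matrix_of_type :: "dynkin \<Rightarrow> int^'i^'i \<Rightarrow> bool" where
  "exchange_matrix_of_type \<Delta> B \<longleftrightarrow> skew_symmetric B \<and>
     (\<exists>B0. mutation_equivalent B B0 \<and>
       (\<exists>\<sigma>. bij_betw \<sigma> UNIV (dynkin_vertices \<Delta>) \<and>
         (\<forall>x y. cartan_counterpart B0 $ x $ y = cartan_matrix \<Delta> (\<sigma> x) (\<sigma> y))))"

text \<open>The arrows of the quiver, \<open>(x, y)\<close> standing for an arrow from \<open>x\<close> to \<open>y\<close>; its vertex set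
  is the whole index type.\<close>

definition quiver :: "int^'i^'i \<Rightarrow> 'i rel" where
  "quiver B = {(x, y). B$x$y > 0}"


section \<open>Root systems\<close>

definition root_system :: "'v::euclidean_space set \<Rightarrow> bool" where
  "root_system \<Phi> \<longleftrightarrow> finite \<Phi> \<and> 0 \<notin> \<Phi> \<and> span \<Phi> = UNIV \<and>
     (\<forall>\<alpha>\<in>\<Phi>. \<forall>c. c *\<^sub>R \<alpha> \<in> \<Phi> \<longrightarrow> c = 1 \<or> c = -1) \<and>
     (\<forall>\<alpha>\<in>\<Phi>. \<forall>\<beta>\<in>\<Phi>. \<beta> - (2 * (\<beta> \<bullet> \<alpha>) / (\<alpha> \<bullet> \<alpha>)) *\<^sub>R \<alpha> \<in> \<Phi>) \<and>
     (\<forall>\<alpha>\<in>\<Phi>. \<forall>\<beta>\<in>\<Phi>. 2 * (\<beta> \<bullet> \<alpha>) / (\<alpha> \<bullet> \<alpha>) \<in> \<int>)"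

definition simple_system :: "'v::euclidean_space set \<Rightarrow> nat set \<Rightarrow> (nat \<Rightarrow> 'v) \<Rightarrow> bool" where
  "simple_system \<Phi> I \<alpha> \<longleftrightarrow> inj_on \<alpha> I \<and> \<alpha> ` I \<subseteq> \<Phi> \<and> independent (\<alpha> ` I) \<and>
     (\<forall>\<beta>\<in>\<Phi>. \<exists>c :: nat \<Rightarrow> nat.
        \<beta> = (\<Sum>i\<in>I. real (c i) *\<^sub>R \<alpha> i) \<or> \<beta> = - (\<Sum>i\<in>I. real (c i) *\<^sub>R \<alpha> i))"

definition root_system_of_type :: "dynkin \<Rightarrow> 'v::euclidean_space set \<Rightarrow> bool" where
  "root_system_of_type \<Delta> \<Phi> \<longleftrightarrow> root_system \<Phi> \<and>
     (\<exists>\<alpha>. simple_system \<Phi> (dynkin_vertices \<Delta>) \<alpha> \<and>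
       (\<forall>i\<in>dynkin_vertices \<Delta>. \<forall>j\<in>dynkin_vertices \<Delta>.
          2 * (\<alpha> i \<bullet> \<alpha> j) / (\<alpha> j \<bullet> \<alpha> j) = real_of_int (cartan_matrix \<Delta> i j)))"

text \<open>The reflection in \<open>\<gamma>\<close>, for vectors normalised by \<open>\<gamma> \<bullet> \<gamma> = 2\<close>.\<close>

definition refl_root :: "'v::real_inner \<Rightarrow> 'v \<Rightarrow> 'v" where
  "refl_root \<gamma> v = v - (v \<bullet> \<gamma>) *\<^sub>R \<gamma>"


section \<open>Companion bases\<close>

definition positive_definite :: "int^'i^'i \<Rightarrow> bool" where
  "positive_definite A \<longleftrightarrow> (\<forall>v :: real^'i. v \<noteq> 0 \<longrightarrow> v \<bullet> (map_matrix real_of_int A *v v) > 0)"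

definition quasi_cartan_companion :: "int^'i^'i \<Rightarrow> int^'i^'i \<Rightarrow> bool" where
  "quasi_cartan_companion A B \<longleftrightarrow> transpose A = A \<and> (\<forall>x. A$x$x = 2) \<and>
     (\<forall>x y. x \<noteq> y \<longrightarrow> \<bar>A$x$y\<bar> = \<bar>B$x$y\<bar>)"

text \<open>Every real vector space as a \<open>\<int>\<close>-module: \<open>int_module.span\<close> is the \<open>\<int>\<close>-span and
  \<open>int_module.independent\<close> is \<open>\<int>\<close>-linear independence.\<close>

interpretation int_module: module "\<lambda>(m::int) (v::'v::real_vector). real_of_int m *\<^sub>R v"
  by unfold_locales (simp_all add: scaleR_add_right scaleR_add_left)

text \<open>\<open>\<gamma>\<close> is the family of basis elements indexed by the vertices.\<close>

definition companion_basis ::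
    "'v::euclidean_space set \<Rightarrow> int^'i^'i \<Rightarrow> ('i \<Rightarrow> 'v) \<Rightarrow> bool" where
  "companion_basis \<Phi> B \<gamma> \<longleftrightarrow> range \<gamma> \<subseteq> \<Phi> \<and>
     inj \<gamma> \<and> int_module.independent (range \<gamma>) \<and>
     int_module.span (range \<gamma>) = int_module.span \<Phi> \<and>
     (\<exists>A :: int^'i^'i. (\<forall>x y. real_of_int (A$x$y) = \<gamma> x \<bullet> \<gamma> y) \<and>
        quasi_cartan_companion A B \<and> positive_definite A)"

definition mutate_inward :: "int^'i^'i \<Rightarrow> 'i \<Rightarrow> ('i \<Rightarrow> 'v::real_inner) \<Rightarrow> 'i \<Rightarrow> 'v" where
  "mutate_inward B k \<gamma> x = (if (x, k) \<in> quiver B then refl_root (\<gamma> k) (\<gamma> x) else \<gamma> x)"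

definition mutate_outward :: "int^'i^'i \<Rightarrow> 'i \<Rightarrow> ('i \<Rightarrow> 'v::real_inner) \<Rightarrow> 'i \<Rightarrow> 'v" where
  "mutate_outward B k \<gamma> x = (if (k, x) \<in> quiver B then refl_root (\<gamma> k) (\<gamma> x) else \<gamma> x)"

end

theory Submission
  imports Defs
begin

text \<open>
  Write \<open>a\<close> for the Gram matrix of the companion basis.  Inward mutation at \<open>k\<close> changes an inner product
  only when exactly one of the two vectors is reflected.  The critical case is a path \<open>x \<rightarrow> k \<rightarrow> y\<close>:
  all entries being 0, 1 or -1, the matrix entry \<open>b x y\<close> becomes \<open>b x y + 1\<close>, while \<open>a x y\<close> becomes
  \<open>a x y - a x k * a k y\<close>.  These agree up to sign when \<open>x\<close> and \<open>y\<close> are not joined.  When they are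
  joined, \<open>x, k, y\<close> is a triangle, and the agreement rests on two properties:

  \<^item> frustration: the product of the numbers \<open>- a\<close> around a chordless cycle is \<open>-1\<close>, since otherwise a
    sum of signed basis vectors would be an affine null vector of type A
    (\<open>chordless_cycle_frustrated\<close>);

  \<^item> orientation: every chordless cycle of the quiver is cyclically oriented
    (\<open>exchange_matrix_cycles_oriented\<close>).

  Then \<open>b x y = -1\<close> and \<open>a x y = a x k * a k y\<close>, so that both sides vanish
  (\<open>companion_family_path\<close>, \<open>companion_family_mutate\<close>).

  Frustration holds for any linearly independent companion family.  Orientation depends on the mutation
  class.  It holds vacuously for the Dynkin quiver: the simple roots have nonpositive inner products,
  which contradicts frustration on any cycle.  It is preserved by mutation of matrices that possess a
  companion family (\<open>all_cycles_oriented_mutate\<close>), by a study of how a chordless cycle of the mutated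
  quiver meets \<open>k\<close>.  The hard case is a cycle avoiding \<open>k\<close> with several neighbours of \<open>k\<close> on it: the
  arcs between consecutive neighbours form chordless cycles with \<open>k\<close>, and comparing their signs with the
  sign of the whole cycle excludes everything except two adjacent neighbours
  (\<open>outside_neighbours_consecutive\<close>).  This follows the ideas of Barot, Geiss and Zelevinsky on
  quasi-Cartan companions of cluster algebras of finite type.

  The family stays inside the roots because it is obtained by reflections, and it keeps its integral
  span because mutation is an integral shear along \<open>\<gamma> k\<close>.  Outward mutation is inward mutation for the
  opposite quiver.
\<close>

section \<open>Entries of skew-symmetric matrices and their mutations\<close>

lemma skew_symmetric_entry:
  assumes "skew_symmetric B" shows "B$y$x = - B$x$y"
proof -
  have "transpose B $ x $ y = (- B) $ x $ y" using assms by (simp only: skew_symmetric_def)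
  then show ?thesis by (simp add: transpose_def)
qed

lemma skew_symmetric_diag: "skew_symmetric B \<Longrightarrow> B$x$x = 0"
  using skew_symmetric_entry[of B x x] by linarith

lemma skew_symmetricI:
  assumes "\<And>x y. B$y$x = - B$x$y" shows "skew_symmetric B"
proof -
  have "transpose B $ x $ y = (- B) $ x $ y" for x y
    using assms[of y x] by (simp add: transpose_def)
  then show ?thesis by (simp only: skew_symmetric_def vec_eq_iff) blast
qed

text \<open>The sign form of the mutation rule: for skew-symmetric \<open>B\<close>, an entry outside row and column \<open>k\<close>
  changes only along a path of length two through \<open>k\<close>, the first case being \<open>x \<rightarrow> k \<rightarrow> y\<close> and the second \<open>y \<rightarrow> k \<rightarrow> x\<close>.\<close>

lemma mutate_entry:
  "mutate k B $ x $ y = (if x = k \<or> y = k then - B$x$y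
     else B$x$y + (if B$x$k > 0 \<and> B$k$y > 0 then B$x$k * B$k$y
                   else if B$x$k < 0 \<and> B$k$y < 0 then - (B$x$k * B$k$y) else 0))"
proof -
  have "(\<bar>a\<bar> * b + a * \<bar>b\<bar>) div 2 = (if a > 0 \<and> b > 0 then a * b
      else if a < 0 \<and> b < 0 then - (a * b) else 0)" for a b :: int
    using nonzero_mult_div_cancel_left[of 2 "- (a * b)"] by (simp add: abs_if not_less)
  then show ?thesis by (simp add: mutate_def)
qed

lemma skew_symmetric_mutate:
  assumes "skew_symmetric B" shows "skew_symmetric (mutate k B)"
proof (rule skew_symmetricI)
  fix x y
  have s: "B$y$x = - B$x$y" "B$y$k = - B$k$y" "B$k$x = - B$x$k"
    using skew_symmetric_entry[OF assms] by metis+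
  show "mutate k B $ y $ x = - mutate k B $ x $ y"
    by (simp only: mutate_entry s) auto
qed

lemma mutate_involutive: "mutate k (mutate k B) = B"
  by (simp add: vec_eq_iff mutate_entry)

lemma skew_symmetric_uminus: "skew_symmetric B \<Longrightarrow> skew_symmetric (- B)"
  by (rule skew_symmetricI) (metis skew_symmetric_entry vector_uminus_component)

lemma mutate_uminus: "mutate k (- B) = - mutate k B"
  by (auto simp: vec_eq_iff mutate_entry)


section \<open>Chordless cycles\<close>

text \<open>A cycle is a parametrisation by \<open>{..<m}\<close> with indices read modulo \<open>m\<close>, so that rotating it is a
  shift of the index; the direction of traversal is part of the parametrisation.\<close>

definition chordless_cycle :: "int^'i^'i \<Rightarrow> nat \<Rightarrow> (nat \<Rightarrow> 'i) \<Rightarrow> bool" where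
  "chordless_cycle B m c \<longleftrightarrow> 3 \<le> m \<and> inj_on c {..<m} \<and>
     (\<forall>i<m. \<forall>j<m. B $ c i $ c j \<noteq> 0 \<longleftrightarrow> j = Suc i mod m \<or> i = Suc j mod m)"

text \<open>A common value \<open>e\<close>, rather than a common sign: the two agree when the entries of \<open>B\<close> are 0, 1 or
  -1, and on a chordless cycle \<open>e\<close> is nonzero.\<close>

definition oriented_cycle :: "int^'i^'i \<Rightarrow> nat \<Rightarrow> (nat \<Rightarrow> 'i) \<Rightarrow> bool" where
  "oriented_cycle B m c \<longleftrightarrow> (\<exists>e. \<forall>i<m. B $ c i $ c (Suc i mod m) = e)"

definition all_cycles_oriented :: "int^'i^'i \<Rightarrow> bool" where
  "all_cycles_oriented B \<longleftrightarrow> (\<forall>m c. chordless_cycle B m c \<longrightarrow> oriented_cycle B m c)"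

lemma all_cycles_orientedE:
  assumes "all_cycles_oriented B" "chordless_cycle B m c"
  obtains e where "\<And>i. i < m \<Longrightarrow> B $ c i $ c (Suc i mod m) = e"
  using assms unfolding all_cycles_oriented_def oriented_cycle_def by blast

lemma Suc_mod_less: "i < m \<Longrightarrow> Suc i mod m = (if Suc i = m then 0 else Suc i)"
  by auto

lemma rotate_index_bij: "0 < (m::nat) \<Longrightarrow> bij_betw (\<lambda>i. (i + s) mod m) {..<m} {..<m}"
proof -
  assume "0 < m"
  have "inj_on (\<lambda>i. (i + s) mod m) {..<m}"
  proof (rule inj_onI)
    fix i j assume i: "i \<in> {..<m}" "j \<in> {..<m}" and "(i + s) mod m = (j + s) mod m"
    then obtain p q where "i + s + m * p = j + s + m * q" by (auto simp: nat_mod_eq_iff)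
    then have "(i + m * p) mod m = (j + m * q) mod m" by simp
    then show "i = j" using i by simp
  qed
  moreover have "(\<lambda>i. (i + s) mod m) ` {..<m} \<subseteq> {..<m}" using \<open>0 < m\<close> by auto
  ultimately show ?thesis
    by (simp add: bij_betw_def endo_inj_surj)
qed

lemma rotate_index_Suc: "Suc ((i + s) mod m) mod m = (Suc i mod m + s) mod m"
  by (simp add: mod_simps)

lemma chordless_cycle_rotate:
  assumes "chordless_cycle B m c"
  shows "chordless_cycle B m (\<lambda>i. c ((i + s) mod m))"
proof -
  have m: "3 \<le> m" "0 < m" using assms by (auto simp: chordless_cycle_def)
  let ?r = "\<lambda>i. (i + s) mod m"
  note r = rotate_index_bij[OF m(2), of s]
  have "inj_on (c \<circ> ?r) {..<m}"
    using assms r by (intro comp_inj_on) (auto simp: chordless_cycle_def bij_betw_def)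
  moreover have "B $ c (?r i) $ c (?r j) \<noteq> 0 \<longleftrightarrow> j = Suc i mod m \<or> i = Suc j mod m"
    if ij: "i < m" "j < m" for i j
  proof -
    have eq: "?r a = Suc (?r b) mod m \<longleftrightarrow> a = Suc b mod m" if "a < m" "b < m" for a b
      using r that m unfolding rotate_index_Suc bij_betw_def inj_on_def by (metis lessThan_iff mod_less_divisor)
    have "B $ c (?r i) $ c (?r j) \<noteq> 0 \<longleftrightarrow> ?r j = Suc (?r i) mod m \<or> ?r i = Suc (?r j) mod m"
      using assms m by (auto simp: chordless_cycle_def)
    then show ?thesis using eq ij by simp
  qed
  ultimately show ?thesis using m by (simp add: chordless_cycle_def comp_def)
qed

lemma oriented_cycle_rotate:
  assumes "oriented_cycle B m (\<lambda>i. c ((i + s) mod m))" "0 < m"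
  shows "oriented_cycle B m c"
proof -
  obtain e where e: "\<And>i. i < m \<Longrightarrow> B $ c ((i + s) mod m) $ c ((Suc i mod m + s) mod m) = e"
    using assms by (auto simp: oriented_cycle_def)
  have "B $ c j $ c (Suc j mod m) = e" if "j < m" for j
  proof -
    have "j \<in> (\<lambda>i. (i + s) mod m) ` {..<m}"
      using rotate_index_bij[OF assms(2), of s] that by (simp add: bij_betw_def)
    then obtain i where "i < m" "j = (i + s) mod m" by auto
    then show ?thesis using e[of i] by (simp add: rotate_index_Suc)
  qed
  then show ?thesis by (auto simp: oriented_cycle_def)
qed

text \<open>Any point of a cycle may be taken as its start; this is how every later argument
  normalises the position of a distinguished vertex.\<close>

lemma oriented_cycle_start_at:
  assumes "chordless_cycle B m c" "s < m"
    and "\<And>d. \<lbrakk>chordless_cycle B m d; d 0 = c s; d ` {..<m} = c ` {..<m};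
            \<And>i. i < m \<Longrightarrow> d i = c ((i + s) mod m)\<rbrakk> \<Longrightarrow> oriented_cycle B m d"
  shows "oriented_cycle B m c"
proof (rule oriented_cycle_rotate)
  show m: "0 < m" using assms by simp
  have "c ` {..<m} = c ` ((\<lambda>i. (i + s) mod m) ` {..<m})"
    using rotate_index_bij[OF m, of s] by (simp add: bij_betw_def)
  then show "oriented_cycle B m (\<lambda>i. c ((i + s) mod m))"
    using assms by (intro assms(3) chordless_cycle_rotate) (auto simp: image_image)
qed

lemma chordless_triangle:
  assumes "skew_symmetric B" "B$x$y \<noteq> 0" "B$y$z \<noteq> 0" "B$z$x \<noteq> 0"
  shows "chordless_cycle B 3 (\<lambda>i. if i = 0 then x else if i = 1 then y else z)"
proof -
  have l: "i < 3 \<longleftrightarrow> i = 0 \<or> i = 1 \<or> i = 2" for i :: nat by auto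
  note s = skew_symmetric_entry[OF assms(1)] and d = skew_symmetric_diag[OF assms(1)]
  have "x \<noteq> y" "y \<noteq> z" "z \<noteq> x" using assms d by auto
  moreover have "B$y$x \<noteq> 0" "B$z$y \<noteq> 0" "B$x$z \<noteq> 0" using assms s by (metis neg_equal_0_iff_equal)+
  ultimately show ?thesis using assms d
    unfolding chordless_cycle_def by (auto simp: l inj_on_def)
qed

section \<open>Companion families\<close>

text \<open>A positive quasi-Cartan companion given by vectors with that Gram matrix; positivity is expressed
  as linear independence over the reals.  This is the part of a companion basis that is carried along
  a mutation sequence.\<close>

definition companion_family :: "int^'i^'i \<Rightarrow> ('i \<Rightarrow> 'v::real_inner) \<Rightarrow> bool" where
  "companion_family B g \<longleftrightarrow> (\<forall>x. g x \<bullet> g x = 2) \<and>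
     (\<forall>x y. x \<noteq> y \<longrightarrow> \<bar>g x \<bullet> g y\<bar> = real_of_int \<bar>B$x$y\<bar>) \<and>
     (\<forall>h. (\<Sum>x\<in>UNIV. h x *\<^sub>R g x) = 0 \<longrightarrow> (\<forall>x. h x = 0))"

lemma companion_family_norm: "companion_family B g \<Longrightarrow> g x \<bullet> g x = 2"
  and companion_family_inner:
    "companion_family B g \<Longrightarrow> x \<noteq> y \<Longrightarrow> \<bar>g x \<bullet> g y\<bar> = real_of_int \<bar>B$x$y\<bar>"
  and companion_family_indep:
    "companion_family B g \<Longrightarrow> (\<Sum>x\<in>UNIV. h x *\<^sub>R g x) = 0 \<Longrightarrow> h x = 0"
  by (auto simp: companion_family_def)

text \<open>The form of independence for vectors listed along an injective parametrisation, such as a cycle.\<close>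

lemma companion_family_indep_on:
  assumes g: "companion_family B g" and c: "inj_on c I" "finite I"
    and 0: "(\<Sum>i\<in>I. h i *\<^sub>R g (c i)) = 0" and i: "i \<in> I"
  shows "h i = 0"
proof -
  define H where "H x = (if x \<in> c ` I then h (the_inv_into I c x) else 0)" for x
  have "(\<Sum>x\<in>UNIV. H x *\<^sub>R g x) = (\<Sum>x\<in>c ` I. H x *\<^sub>R g x)"
    by (rule sum.mono_neutral_right) (auto simp: H_def)
  also have "\<dots> = (\<Sum>i\<in>I. h i *\<^sub>R g (c i))"
    using c by (simp add: sum.reindex H_def the_inv_into_f_f)
  finally have "H (c i) = 0" using companion_family_indep[OF g] 0 by metis
  then show ?thesis using c i by (simp add: H_def the_inv_into_f_f)
qed

text \<open>Two independent vectors of squared length 2 have an inner product of absolute value less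
  than 2, hence at most 1 when it is an integer.\<close>

lemma companion_family_entry_le:
  assumes g: "companion_family B g" and B: "skew_symmetric B"
  shows "\<bar>B$x$y\<bar> \<le> 1"
proof (cases "x = y")
  case True then show ?thesis using skew_symmetric_diag[OF B] by simp
next
  case False
  show ?thesis
  proof (rule ccontr)
    assume "\<not> ?thesis"
    then have ge: "\<bar>g x \<bullet> g y\<bar> \<ge> 2"
      unfolding companion_family_inner[OF g False] by linarith
    define e where "e = sgn (g x \<bullet> g y)"
    have e: "e * (g x \<bullet> g y) \<ge> 2" "e * e = 1" using ge by (auto simp: e_def sgn_if abs_if split: if_splits)
    have "(g x - e *\<^sub>R g y) \<bullet> (g x - e *\<^sub>R g y)
        = g x \<bullet> g x + (e * e) * (g y \<bullet> g y) - 2 * (e * (g x \<bullet> g y))"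
      by (simp add: inner_diff inner_commute algebra_simps)
    also have "\<dots> \<le> 0" using e by (simp add: companion_family_norm[OF g])
    finally have "g x - e *\<^sub>R g y = 0" by (metis inner_eq_zero_iff inner_ge_zero order_antisym)
    then have "(\<Sum>z\<in>{x,y}. (if z = x then 1 else - e) *\<^sub>R g (id z)) = 0" using False by simp
    from companion_family_indep_on[OF g _ _ this, of x] show False by auto
  qed
qed

lemma companion_family_edge:
  assumes g: "companion_family B g" and B: "skew_symmetric B" and "B$x$y \<noteq> 0"
  shows "\<bar>g x \<bullet> g y\<bar> = 1" "(g x \<bullet> g y) * (g x \<bullet> g y) = 1"
proof -
  have "x \<noteq> y" using assms skew_symmetric_diag[OF B] by auto
  then show "\<bar>g x \<bullet> g y\<bar> = 1"
    using companion_family_inner[OF g] companion_family_entry_le[OF g B, of x y] assms by simp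
  then show "(g x \<bullet> g y) * (g x \<bullet> g y) = 1" by (metis abs_mult_self_eq mult_1)
qed

text \<open>If the product below were 1, one could choose signs \<open>h\<close> along the cycle such that
  consecutive vectors \<open>h i *\<^sub>R g (c i)\<close> have inner product -1.  The sum of these vectors is then
  orthogonal to each of them, as \<open>2 - 1 - 1 = 0\<close>, hence it vanishes (it is the radical vector of
  an affine diagram of type A), against independence.\<close>

lemma chordless_cycle_frustrated:
  assumes g: "companion_family B g" and B: "skew_symmetric B" and c: "chordless_cycle B m c"
  shows "(\<Prod>i<m. - (g (c i) \<bullet> g (c (Suc i mod m)))) = -1"
proof (rule ccontr)
  define f where "f i = - (g (c i) \<bullet> g (c (Suc i mod m)))" for i
  define h where "h i = (\<Prod>j<i. f j)" for i
  have m: "3 \<le> m" and inj: "inj_on c {..<m}"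
    and adj: "\<And>i j. i < m \<Longrightarrow> j < m \<Longrightarrow> B $ c i $ c j \<noteq> 0 \<longleftrightarrow> j = Suc i mod m \<or> i = Suc j mod m"
    using c by (auto simp: chordless_cycle_def)
  have edge: "B $ c i $ c (Suc i mod m) \<noteq> 0" if "i < m" for i
    using adj[of i "Suc i mod m"] that by simp
  have f: "f i * f i = 1" "\<bar>f i\<bar> = 1" if "i < m" for i
    using companion_family_edge[OF g B edge[OF that]] by (simp_all add: f_def)
  have h: "\<bar>h i\<bar> = 1" if "i \<le> m" for i
    using that unfolding h_def abs_prod by (intro prod.neutral) (auto simp: f)
  assume "\<not> ?thesis"
  then have "h m \<noteq> -1" by (simp add: h_def f_def)
  then have hm: "h m = 1" using h[of m] by linarith
  have step: "h (Suc i mod m) = f i * h i" if "i < m" for i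
  proof -
    have "h (Suc i) = f i * h i" by (simp add: h_def)
    moreover have "h 0 = 1" by (simp add: h_def)
    ultimately show ?thesis using that hm by (auto simp: Suc_mod_less)
  qed
  define w where "w = (\<Sum>i<m. h i *\<^sub>R g (c i))"
  have "w \<bullet> g (c j) = 0" if j: "j < m" for j
  proof -
    let ?s = "Suc j mod m" and ?p = "if j = 0 then m - 1 else j - 1"
    have p: "?p < m" "Suc ?p mod m = j" using j m by auto
    have d: "j \<noteq> ?s" "j \<noteq> ?p" "?s \<noteq> ?p" "?s < m" using j m by (auto simp: Suc_mod_less)
    have "w \<bullet> g (c j) = (\<Sum>i<m. h i * (g (c i) \<bullet> g (c j)))"
      by (simp add: w_def inner_sum_left)
    also have "\<dots> = (\<Sum>i\<in>{j, ?s, ?p}. h i * (g (c i) \<bullet> g (c j)))"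
    proof (rule sum.mono_neutral_right)
      show "\<forall>i\<in>{..<m} - {j, ?s, ?p}. h i * (g (c i) \<bullet> g (c j)) = 0"
      proof
        fix i assume i: "i \<in> {..<m} - {j, ?s, ?p}"
        then have "j \<noteq> Suc i mod m" using m by (auto simp: Suc_mod_less split: if_splits)
        then have "B $ c i $ c j = 0" using adj[of i j] i j by auto
        moreover have "c i \<noteq> c j" using inj i j by (auto simp: inj_on_def)
        ultimately show "h i * (g (c i) \<bullet> g (c j)) = 0"
          using companion_family_inner[OF g, of "c i" "c j"] by simp
      qed
    qed (use j p d in auto)
    also have "\<dots> = h j * 2 + h ?s * (g (c ?s) \<bullet> g (c j)) + h ?p * (g (c ?p) \<bullet> g (c j))"
      using d by (simp add: companion_family_norm[OF g])
    also have "h ?s * (g (c ?s) \<bullet> g (c j)) = - (f j * f j) * h j"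
      using step[OF j] by (simp add: f_def inner_commute)
    also have "h ?p * (g (c ?p) \<bullet> g (c j)) = - (f ?p * h ?p)"
      using p by (simp add: f_def)
    also have "f ?p * h ?p = h j" using step[OF p(1)] p by simp
    finally show ?thesis by (simp add: f[OF j])
  qed
  then have "w \<bullet> w = 0" by (subst (2) w_def) (simp add: inner_sum_right)
  then have "w = 0" by simp
  then have "h 0 = 0"
    using companion_family_indep_on[OF g inj, of h 0] m by (simp add: w_def)
  then show False by (simp add: h_def)
qed

section \<open>Mutation of companion families\<close>

text \<open>The only entries for which the change of the matrix and the change of the inner product
  differ in form are those along a path \<open>x \<rightarrow> k \<rightarrow> y\<close>.  If \<open>x\<close> and \<open>y\<close> are joined, then \<open>x, k, y\<close>
  is a triangle: its orientation makes the new matrix entry vanish, and its frustration makes the new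
  inner product vanish.\<close>

lemma companion_family_path:
  assumes g: "companion_family B g" and B: "skew_symmetric B" and O: "all_cycles_oriented B"
    and pos: "B$x$k > 0" "B$k$y > 0"
  shows "\<bar>g x \<bullet> g y - (g x \<bullet> g k) * (g y \<bullet> g k)\<bar> = real_of_int \<bar>B$x$y + B$x$k * B$k$y\<bar>"
proof -
  note le = companion_family_entry_le[OF g B]
  have one: "B$x$k = 1" "B$k$y = 1" using pos le[of x k] le[of k y] by auto
  have sk: "B$y$x = - B$x$y" "B$y$k = -1" using skew_symmetric_entry[OF B] one by metis+
  have ne: "x \<noteq> y" using one sk by auto
  have a: "\<bar>g x \<bullet> g k\<bar> = 1" "\<bar>g y \<bullet> g k\<bar> = 1"
    using companion_family_edge(1)[OF g B, of x k] companion_family_edge(1)[OF g B, of y k] one sk by auto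
  show ?thesis
  proof (cases "B$x$y = 0")
    case True
    then have "g x \<bullet> g y = 0" using companion_family_inner[OF g ne] by simp
    then show ?thesis using True a one by (simp add: abs_mult)
  next
    case False
    let ?c = "\<lambda>i::nat. if i = 0 then x else if i = 1 then k else y"
    have c: "chordless_cycle B 3 ?c"
      using chordless_triangle[OF B, of x k y] one sk False by auto
    have l3: "{..<3} = {0, 1, 2::nat}" by auto
    from all_cycles_orientedE[OF O c] obtain e
      where "\<And>i. i < 3 \<Longrightarrow> B $ ?c i $ ?c (Suc i mod 3) = e" by metis
    from this[of 0] this[of 2] have "B$y$x = 1" using one by simp
    then have xy: "B$x$y = -1" using sk by simp
    have "(g x \<bullet> g k) * (g y \<bullet> g k) * (g x \<bullet> g y) = 1"
      using chordless_cycle_frustrated[OF g B c] by (simp add: l3 inner_commute mult_ac)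
    moreover have "(g x \<bullet> g y) * (g x \<bullet> g y) = 1"
      using companion_family_edge(2)[OF g B False] .
    ultimately have "g x \<bullet> g y = (g x \<bullet> g k) * (g y \<bullet> g k)"
      by (metis mult.assoc mult.left_neutral mult.right_neutral)
    then show ?thesis using xy one by simp
  qed
qed

text \<open>Since \<open>g k\<close> itself stays fixed, inward mutation is a shear along \<open>g k\<close>; this gives both
  independence and, later, equality of the integral spans.\<close>

lemma mutate_inward_shear:
  "mutate_inward B k g x = g x - (if B$x$k > 0 then g x \<bullet> g k else 0) *\<^sub>R g k"
  by (simp add: mutate_inward_def quiver_def refl_root_def)

text \<open>A reflection is an isometry, so inner products change only when exactly one of the two vectors
  is reflected, that is for an arrow \<open>x \<rightarrow> k\<close> and a vertex \<open>y\<close> with no arrow into \<open>k\<close>.  If \<open>y = k\<close>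
  both the entry and the inner product change their sign, if \<open>y\<close> is not joined to \<open>k\<close> neither changes,
  and otherwise \<open>x \<rightarrow> k \<rightarrow> y\<close> is the path treated above.\<close>

lemma companion_family_mutate:
  assumes g: "companion_family B g" and B: "skew_symmetric B" and O: "all_cycles_oriented B"
  shows "companion_family (mutate k B) (mutate_inward B k g)"
  unfolding companion_family_def
proof (intro conjI allI impI)
  define t where "t x = (if B$x$k > 0 then g x \<bullet> g k else 0)" for x
  let ?g = "mutate_inward B k g"
  have g': "?g x = g x - t x *\<^sub>R g k" for x by (simp add: mutate_inward_shear t_def)
  have inner: "?g x \<bullet> ?g y = g x \<bullet> g y - t x * (g y \<bullet> g k) - t y * (g x \<bullet> g k) + 2 * t x * t y" for x y
    by (simp add: g' inner_diff companion_family_norm[OF g] inner_commute algebra_simps)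
  show "?g x \<bullet> ?g x = 2" for x
    unfolding inner by (simp add: t_def companion_family_norm[OF g])
  have kk: "B$k$k = 0" by (rule skew_symmetric_diag[OF B])
  have half: "\<bar>?g x \<bullet> ?g y\<bar> = real_of_int \<bar>mutate k B $ x $ y\<bar>"
    if ne: "x \<noteq> y" and x: "B$x$k > 0" and y: "\<not> B$y$k > 0" for x y
  proof -
    have xk: "x \<noteq> k" using x kk by auto
    have ky: "B$k$y = - B$y$k" using skew_symmetric_entry[OF B] .
    have eq: "?g x \<bullet> ?g y = g x \<bullet> g y - (g x \<bullet> g k) * (g y \<bullet> g k)"
      unfolding inner using x y by (simp add: t_def)
    consider "y = k" | "y \<noteq> k" "B$y$k = 0" | "y \<noteq> k" "B$k$y > 0" using y ky by linarith
    then show ?thesis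
    proof cases
      case 1
      then show ?thesis using eq companion_family_inner[OF g ne] xk
        by (simp add: companion_family_norm[OF g] mutate_entry)
    next
      case 2
      then have "g y \<bullet> g k = 0" using companion_family_inner[OF g, of y k] by simp
      then show ?thesis using eq companion_family_inner[OF g ne] xk 2 ky
        by (simp add: mutate_entry)
    next
      case 3
      then show ?thesis using eq companion_family_path[OF g B O x 3(2)] xk x
        by (simp add: mutate_entry)
    qed
  qed
  show "\<bar>?g x \<bullet> ?g y\<bar> = real_of_int \<bar>mutate k B $ x $ y\<bar>" if ne: "x \<noteq> y" for x y
  proof (cases "B$x$k > 0 \<longleftrightarrow> B$y$k > 0")
    case True
    have ky: "B$k$y = - B$y$k" using skew_symmetric_entry[OF B] .
    have "\<bar>mutate k B $ x $ y\<bar> = \<bar>B$x$y\<bar>" using True ky by (auto simp: mutate_entry)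
    moreover have "?g x \<bullet> ?g y = g x \<bullet> g y" unfolding inner using True by (simp add: t_def)
    ultimately show ?thesis using companion_family_inner[OF g ne] by simp
  next
    case False
    have "\<bar>mutate k B $ y $ x\<bar> = \<bar>mutate k B $ x $ y\<bar>"
      using skew_symmetric_entry[OF skew_symmetric_mutate[OF B]] by (metis abs_minus_cancel)
    then show ?thesis using half[of x y] half[of y x] ne False by (metis inner_commute)
  qed
  show "h x = 0" if h: "(\<Sum>x\<in>UNIV. h x *\<^sub>R ?g x) = 0" for h x
  proof -
    \<comment> \<open>Rewritten in terms of \<open>g\<close>, only the coefficient at \<open>k\<close> changes, by \<open>S\<close>; all others vanish, and
      the vector at \<open>k\<close> does not contribute to \<open>S\<close>.\<close>
    define S where "S = (\<Sum>x\<in>UNIV. h x * t x)"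
    have "0 = (\<Sum>x\<in>UNIV. h x *\<^sub>R g x) - S *\<^sub>R g k"
      using h by (simp add: g' scaleR_diff_right sum_subtractf S_def scaleR_sum_left)
    also have "S *\<^sub>R g k = (\<Sum>x\<in>UNIV. (if x = k then S else 0) *\<^sub>R g x)"
      by (simp add: if_distrib[of "\<lambda>r. r *\<^sub>R _"] cong: if_cong)
    finally have "(\<Sum>x\<in>UNIV. (h x - (if x = k then S else 0)) *\<^sub>R g x) = 0"
      by (simp add: scaleR_diff_left sum_subtractf)
    from companion_family_indep[OF g this] have hx: "h x = (if x = k then S else 0)" for x
      by (metis eq_iff_diff_eq_0)
    have "S = 0"
      unfolding S_def by (rule sum.neutral) (use hx kk in \<open>auto simp: t_def\<close>)
    then show ?thesis using hx by simp
  qed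
qed

section \<open>Mutation preserves the orientation of cycles\<close>

lemma chordless_cycleD:
  assumes "chordless_cycle B m c"
  shows "3 \<le> m" "inj_on c {..<m}"
    "i < m \<Longrightarrow> j < m \<Longrightarrow> B $ c i $ c j \<noteq> 0 \<longleftrightarrow> j = Suc i mod m \<or> i = Suc j mod m"
  using assms by (auto simp: chordless_cycle_def)

text \<open>Let \<open>p\<close> and \<open>q\<close> be the entries of the mutated matrix \<open>M\<close> on the two edges of the cycle at \<open>k\<close>.  If
  \<open>p \<noteq> q\<close>, then \<open>k\<close> is a source or sink of the cycle, mutating back only reverses its arrows, and \<open>B\<close>
  would have a chordless cycle that is not oriented at \<open>k\<close>.  If \<open>p = q\<close>, then mutating back joins the
  two neighbours of \<open>k\<close> and leaves a shorter chordless cycle without \<open>k\<close>, which is oriented in \<open>B\<close>;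
  for \<open>m = 3\<close> the wrong orientation would create an entry of absolute value 2 in \<open>B\<close>.\<close>

lemma oriented_cycle_through_start:
  assumes g: "companion_family B g" and B: "skew_symmetric B" and O: "all_cycles_oriented B"
    and c: "chordless_cycle (mutate k B) m c" and k: "c 0 = k"
  shows "oriented_cycle (mutate k B) m c"
proof -
  define M where "M = mutate k B"
  have BM: "B = mutate k M" by (simp add: M_def mutate_involutive)
  have M: "skew_symmetric M" unfolding M_def by (rule skew_symmetric_mutate[OF B])
  note s = skew_symmetric_entry[OF M]
  have le: "\<bar>M$x$y\<bar> \<le> 1" for x y
    using companion_family_entry_le[OF companion_family_mutate[OF g B O] M[unfolded M_def]]
    by (simp add: M_def)
  note leB = companion_family_entry_le[OF g B]
  note c = c[folded M_def]
  note m = chordless_cycleD(1)[OF c] and inj = chordless_cycleD(2)[OF c]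
    and adj = chordless_cycleD(3)[OF c]
  define p where "p = M $ k $ c 1"
  define q where "q = M $ c (m - 1) $ k"
  have pq: "p = 1 \<or> p = -1" "q = 1 \<or> q = -1"
    using adj[of 0 1] adj[of "m - 1" 0] m k le[of k "c 1"] le[of "c (m - 1)" k] by (auto simp: p_def q_def)
  have Mk: "M $ c i $ k = (if i = 1 then -p else if i = m - 1 then q else 0)" if i: "i < m" for i
  proof -
    have "M $ c i $ k = 0" if "i \<noteq> 1" "i \<noteq> m - 1"
      using adj[of i 0] that i m k by (auto simp: Suc_mod_less split: if_splits)
    then show ?thesis using s[of "c 1" k] by (auto simp: p_def q_def)
  qed
  have kM: "M $ k $ c i = - M $ c i $ k" for i by (rule s)
  have ck: "c i = k \<longleftrightarrow> i = 0" if "i < m" for i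
    using inj that m k by (auto simp: inj_on_def)
  show ?thesis
  proof (cases "p = q")
    case False
    have eq: "B $ c i $ c j = (if i = 0 \<or> j = 0 then - M $ c i $ c j else M $ c i $ c j)"
      if "i < m" "j < m" for i j
      unfolding BM mutate_entry using that pq False
      by (auto simp: ck kM Mk)
    have "chordless_cycle B m c"
      using c eq unfolding chordless_cycle_def by auto
    from all_cycles_orientedE[OF O this]
    obtain e where e: "\<And>i. i < m \<Longrightarrow> B $ c i $ c (Suc i mod m) = e" by metis
    have "e = - p" using e[of 0] eq[of 0 1] m k by (simp add: p_def)
    moreover have "e = - q" using e[of "m - 1"] eq[of "m - 1" 0] m k by (simp add: q_def)
    ultimately show ?thesis using False by simp
  next
    case True
    have eq: "B $ c i $ c j = M $ c i $ c j + (if i = 1 \<and> j = m - 1 then - p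
        else if i = m - 1 \<and> j = 1 then p else 0)"
      if "0 < i" "i < m" "0 < j" "j < m" for i j
      unfolding BM mutate_entry using that pq m True
      by (auto simp: ck kM Mk)
    have "M $ c i $ c (Suc i) = p" if i: "0 < i" "Suc i < m" for i
    proof (cases "m = 3")
      case m3: True
      have "M $ c 1 $ c 2 \<noteq> 0" using adj[of 1 2] m3 by simp
      moreover have "B $ c 1 $ c 2 = M $ c 1 $ c 2 - p" using eq[of 1 2] m3 by simp
      ultimately have "M $ c 1 $ c 2 = p" using pq le[of "c 1" "c 2"] leB[of "c 1" "c 2"] by auto
      moreover have "i = 1" using i m3 by simp
      ultimately show ?thesis by (simp add: numeral_2_eq_2)
    next
      case m4: False
      let ?n = "m - 1" and ?d = "\<lambda>i. c (Suc i)"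
      have "M $ c (m - 1) $ c 1 = 0" using adj[of "m - 1" 1] m m4 by (auto simp: Suc_mod_less)
      then have cl: "B $ c (m - 1) $ c 1 = p" using eq[of "m - 1" 1] m m4 by (auto split: if_splits)
      have "chordless_cycle B ?n ?d"
        unfolding chordless_cycle_def
      proof (intro conjI allI impI)
        show "3 \<le> ?n" using m m4 by simp
        show "inj_on ?d {..<?n}"
        proof (rule inj_onI)
          fix a b assume "a \<in> {..<?n}" "b \<in> {..<?n}" "?d a = ?d b"
          then show "a = b" using inj_onD[OF inj, of "Suc a" "Suc b"] by auto
        qed
        fix i j assume ij: "i < ?n" "j < ?n"
        have Mij: "M $ ?d i $ ?d j \<noteq> 0 \<longleftrightarrow> j = Suc i \<or> i = Suc j"
        proof -
          have "M $ ?d i $ ?d j \<noteq> 0 \<longleftrightarrow> Suc j = Suc (Suc i) mod m \<or> Suc i = Suc (Suc j) mod m"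
            using ij by (intro adj) auto
          also have "\<dots> \<longleftrightarrow> j = Suc i \<or> i = Suc j"
            using ij by (auto simp: Suc_mod_less)
          finally show ?thesis .
        qed
        have Bij: "B $ ?d i $ ?d j = M $ ?d i $ ?d j + (if Suc i = 1 \<and> Suc j = m - 1 then - p
            else if Suc i = m - 1 \<and> Suc j = 1 then p else 0)"
          using ij by (intro eq) auto
        show "B $ ?d i $ ?d j \<noteq> 0 \<longleftrightarrow> j = Suc i mod ?n \<or> i = Suc j mod ?n"
        proof (cases "i = 0 \<and> Suc j = ?n \<or> Suc i = ?n \<and> j = 0")
          case True
          then have "M $ ?d i $ ?d j = 0" using Mij m m4 by auto
          then have "B $ ?d i $ ?d j \<noteq> 0" using Bij True pq by auto
          then show ?thesis using True by auto
        next
          case False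
          then have "B $ ?d i $ ?d j = M $ ?d i $ ?d j" using Bij by auto
          then show ?thesis using Mij False ij by (auto simp: Suc_mod_less)
        qed
      qed
      from all_cycles_orientedE[OF O this]
      obtain e where e: "\<And>i. i < ?n \<Longrightarrow> B $ ?d i $ ?d (Suc i mod ?n) = e" by metis
      have "e = p" using e[of "m - 2"] cl m by (simp add: Suc_mod_less numeral_2_eq_2 Suc_diff_Suc)
      moreover have "B $ c i $ c (Suc i) = e" using e[of "i - 1"] i by (simp add: Suc_mod_less)
      moreover have "\<not> (i = 1 \<and> Suc i = m - 1)" "\<not> (i = m - 1 \<and> Suc i = 1)" using i m4 by linarith+
      then have "B $ c i $ c (Suc i) = M $ c i $ c (Suc i)" using eq[of i "Suc i"] i by (auto split: if_splits)
      ultimately show ?thesis by simp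
    qed
    then have "M $ c i $ c (Suc i mod m) = p" if "i < m" for i
      using that True k by (cases "i = 0"; cases "Suc i = m") (auto simp: p_def q_def)
    then show ?thesis unfolding M_def oriented_cycle_def by blast
  qed
qed

lemma prod_lessThan_add: "(\<Prod>t<i + (p::nat). f t) = (\<Prod>t<i. f t) * (\<Prod>t<p. f (i + t))"
  for f :: "nat \<Rightarrow> 'a::comm_monoid_mult"
  by (induction p) (simp_all add: mult.assoc)

lemma prod_lessThan_ends:
  "(\<Prod>t<Suc (Suc p). f t) = f 0 * (\<Prod>t<p. f (Suc t)) * f (Suc p)"
  for f :: "nat \<Rightarrow> 'a::comm_monoid_mult"
  by (subst prod.lessThan_Suc_shift) (simp only: prod.lessThan_Suc mult.assoc)

text \<open>The first and last neighbour of \<open>k\<close> on an arc without further neighbours close up with \<open>k\<close> to a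
  chordless cycle, unless the rest of the cycle is a single edge; as \<open>k\<close> has at least two neighbours, this
  exception is the conclusion.  Otherwise every such arc-cycle is oriented at \<open>k\<close> and frustrated.
  Put \<open>\<delta> j\<close> for the product of the matrix entry and the inner product of \<open>k\<close> with the \<open>j\<close>-th vertex.  Orientation turns the sign -1 of
  the arc-cycle into the rule that the product of \<open>-(g _ \<bullet> g _)\<close> along the arc carries \<open>\<delta>\<close> at its
  start to \<open>\<delta>\<close> at its end.  Walking once around the cycle then gives total product 1, although the
  cycle is itself frustrated.\<close>

lemma outside_neighbours_consecutive:
  assumes g: "companion_family M g" and M: "skew_symmetric M"
    and c: "chordless_cycle M m c" and k: "k \<notin> c ` {..<m}"
    and through: "\<And>n d. chordless_cycle M n d \<Longrightarrow> d 0 = k \<Longrightarrow> oriented_cycle M n d"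
    and nb0: "M $ k $ c 0 \<noteq> 0" and r: "0 < r" "r < m" "M $ k $ c r \<noteq> 0"
  shows "\<exists>s<m. \<forall>i<m. M $ k $ c i \<noteq> 0 \<longleftrightarrow> i = s \<or> i = Suc s mod m"
proof (rule ccontr)
  assume none: "\<not> ?thesis"
  have neg: False if "s < m" "\<And>i. i < m \<Longrightarrow> M $ k $ c i \<noteq> 0 \<longleftrightarrow> i = s \<or> i = Suc s mod m" for s
    using none that by blast
  note m = chordless_cycleD(1)[OF c] and inj = chordless_cycleD(2)[OF c]
    and adj = chordless_cycleD(3)[OF c] and sk = skew_symmetric_entry[OF M]
  \<comment> \<open>Unrolling the cycle to indices \<open>0..m\<close> lets the last arc end at the start vertex.\<close>
  define d where "d j = c (j mod m)" for j
  have dc: "d j = c j" if "j < m" for j using that by (simp add: d_def)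
  have dm: "d m = c 0" by (simp add: d_def)
  define nb where "nb j \<longleftrightarrow> M $ k $ d j \<noteq> 0" for j
  define f where "f j = - (g (d j) \<bullet> g (d (Suc j)))" for j
  define \<delta> where "\<delta> j = real_of_int (M $ k $ d j) * (g k \<bullet> g (d j))" for j
  have \<delta>: "\<delta> j * \<delta> j = 1" if "nb j" for j
  proof -
    have nz: "M $ k $ d j \<noteq> 0" using that by (simp add: nb_def)
    have "\<bar>M $ k $ d j\<bar> = 1" using companion_family_entry_le[OF g M, of k "d j"] nz by linarith
    then have "M $ k $ d j * M $ k $ d j = 1" by (metis abs_mult_self_eq mult_1)
    then have "real_of_int (M $ k $ d j) * real_of_int (M $ k $ d j) = 1"
      by (metis of_int_1 of_int_mult)
    moreover have "\<delta> j * \<delta> j = (real_of_int (M $ k $ d j) * real_of_int (M $ k $ d j))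
        * ((g k \<bullet> g (d j)) * (g k \<bullet> g (d j)))" by (simp add: \<delta>_def mult_ac)
    ultimately show ?thesis using companion_family_edge(2)[OF g M nz] by simp
  qed
  have arc: "\<delta> i * \<delta> j * (\<Prod>t<j - i. f (i + t)) = 1"
    if ij: "i < j" "j \<le> m" and nbi: "nb i" and nbj: "nb j" and between: "\<And>t. i < t \<Longrightarrow> t < j \<Longrightarrow> \<not> nb t"
    for i j
  proof -
    have "\<not> (i = 0 \<and> j = m)" using between[of r] r by (auto simp: nb_def dc)
    moreover have "\<not> (i = 0 \<and> j = m - 1)"
    proof
      assume a: "i = 0 \<and> j = m - 1"
      show False
      proof (rule neg[of "m - 1"])
        fix t assume t: "t < m"
        have "nb t \<longleftrightarrow> t = m - 1 \<or> t = 0"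
          using between[of t] nbi nbj a t by (cases "t = 0"; cases "t = m - 1") auto
        then show "M $ k $ c t \<noteq> 0 \<longleftrightarrow> t = m - 1 \<or> t = Suc (m - 1) mod m"
          using t m by (simp add: nb_def dc)
      qed (use m in simp)
    qed
    moreover have "\<not> (i = 1 \<and> j = m)"
    proof
      assume a: "i = 1 \<and> j = m"
      show False
      proof (rule neg[of 0])
        fix t assume t: "t < m"
        have "nb t \<longleftrightarrow> t = 0 \<or> t = 1"
          using between[of t] nbi nb0 dc[of 0] a t m by (cases "t = 0"; cases "t = 1") (auto simp: nb_def)
        then show "M $ k $ c t \<noteq> 0 \<longleftrightarrow> t = 0 \<or> t = Suc 0 mod m"
          using t m by (simp add: nb_def dc)
      qed (use m in simp)
    qed
    \<comment> \<open>At least two edges of the cycle remain outside the arc, so that the arc is an induced path.\<close>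
    ultimately have short: "j - i + 2 \<le> m" using ij m by linarith
    have path: "M $ d t $ d u \<noteq> 0 \<longleftrightarrow> u = Suc t" "d t \<noteq> d u" if "i \<le> t" "t < u" "u \<le> j" for t u
    proof -
      have t: "t < m" "d t = c t" using that ij by (auto simp: dc)
      show "M $ d t $ d u \<noteq> 0 \<longleftrightarrow> u = Suc t"
      proof (cases "u = m")
        case True
        then have u: "d u = c 0" using dm by simp
        have "M $ c t $ c 0 \<noteq> 0 \<longleftrightarrow> 0 = Suc t mod m \<or> t = Suc 0 mod m"
          using t m by (intro adj) auto
        also have "\<dots> \<longleftrightarrow> u = Suc t"
          using True t that ij short m by (auto simp: Suc_mod_less)
        finally show ?thesis unfolding t(2) u .
      next
        case False
        then have "u < m" using that ij by simp
        then have u: "u < m" "d u = c u" using dc by auto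
        have "M $ c t $ c u \<noteq> 0 \<longleftrightarrow> u = Suc t mod m \<or> t = Suc u mod m"
          using t u by (intro adj) auto
        also have "\<dots> \<longleftrightarrow> u = Suc t"
          using u(1) t that ij short by (auto simp: Suc_mod_less)
        finally show ?thesis unfolding t(2) u(2) .
      qed
      show "d t \<noteq> d u"
      proof (cases "u = m")
        case True
        then have "d u = c 0" "t \<noteq> 0" using dm that ij short by auto
        then show ?thesis using inj_on_eq_iff[OF inj, of t 0] t m by simp
      next
        case False
        then have "u < m" using that ij by simp
        then show ?thesis using inj_on_eq_iff[OF inj, of t u] dc t that by simp
      qed
    qed
    have pathS: "M $ d t $ d u \<noteq> 0 \<longleftrightarrow> u = Suc t \<or> t = Suc u"
      if "i \<le> t" "t \<le> j" "i \<le> u" "u \<le> j" for t u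
      using path(1)[of t u] path(1)[of u t] that sk[of "d t" "d u"] skew_symmetric_diag[OF M, of "d t"]
      by (cases t u rule: linorder_cases) auto
    have kd: "d t \<noteq> k" if "t \<le> m" for t
    proof -
      have "t mod m < m" using m by simp
      then show ?thesis using k unfolding d_def by (metis image_eqI lessThan_iff)
    qed
    have nbd: "M $ k $ d t \<noteq> 0 \<longleftrightarrow> t = i \<or> t = j" if "i \<le> t" "t \<le> j" for t
      using between[of t] nbi nbj that unfolding nb_def by (metis le_neq_implies_less)
    define n where "n = Suc (Suc (j - i))"
    define e where "e t = (if t = 0 then k else d (i + t - 1))" for t
    have e_arc: "e t = d (i + (t - 1))" "i \<le> i + (t - 1)" "i + (t - 1) \<le> j" if "t \<noteq> 0" "t < n" for t
      using that ij by (auto simp: e_def n_def)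
    \<comment> \<open>The closed arc: first \<open>k\<close>, then the \<open>j - i + 1\<close> vertices of the arc.\<close>
    have ch: "chordless_cycle M n e"
      unfolding chordless_cycle_def
    proof (intro conjI allI impI)
      show "3 \<le> n" using ij by (simp add: n_def)
      show "inj_on e {..<n}"
      proof (rule linorder_inj_onI')
        fix a b assume ab: "a \<in> {..<n}" "b \<in> {..<n}" "a < b"
        then have b: "e b = d (i + (b - 1))" "i + (b - 1) \<le> j" using e_arc[of b] by auto
        show "e a \<noteq> e b"
        proof (cases "a = 0")
          case True
          then show ?thesis using kd[of "i + (b - 1)"] b ij by (simp add: e_def)
        next
          case False
          then show ?thesis using path(2)[of "i + (a - 1)" "i + (b - 1)"] b e_arc[of a] ab by auto
        qed
      qed
      fix a b assume ab: "a < n" "b < n"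
      have z: "M $ k $ e t \<noteq> 0 \<longleftrightarrow> t = 1 \<or> t = n - 1" if "t < n" "t \<noteq> 0" for t
        using nbd[of "i + (t - 1)"] e_arc[of t] that ij by (auto simp: n_def)
      have z': "M $ e t $ k \<noteq> 0 \<longleftrightarrow> t = 1 \<or> t = n - 1" if "t < n" "t \<noteq> 0" for t
        using z[OF that] sk[of k "e t"] by simp
      have e0: "e 0 = k" by (simp add: e_def)
      consider "a = 0" "b = 0" | "a = 0" "b \<noteq> 0" | "a \<noteq> 0" "b = 0" | "a \<noteq> 0" "b \<noteq> 0" by blast
      then show "M $ e a $ e b \<noteq> 0 \<longleftrightarrow> b = Suc a mod n \<or> a = Suc b mod n"
      proof cases
        case 1
        then show ?thesis using skew_symmetric_diag[OF M] by (simp add: n_def)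
      next
        case 2
        then show ?thesis using z[of b] ab ij by (auto simp: e0 Suc_mod_less n_def split: if_splits)
      next
        case 3
        then show ?thesis using z'[of a] ab ij by (auto simp: e0 Suc_mod_less n_def split: if_splits)
      next
        case 4
        then show ?thesis using pathS[of "i + (a - 1)" "i + (b - 1)"] e_arc[of a] e_arc[of b] ab
          by (auto simp: Suc_mod_less split: if_splits)
      qed
    qed
    have ends: "e 0 = k" "e (Suc 0) = d i" "e (Suc (j - i)) = d j" using ij by (auto simp: e_def)
    obtain w where w: "\<And>t. t < n \<Longrightarrow> M $ e t $ e (Suc t mod n) = w"
      using through[OF ch ends(1)] unfolding oriented_cycle_def by metis
    have "M $ k $ d i = w" using w[of 0] ends by (simp add: n_def)
    moreover have "M $ d j $ k = w" using w[of "Suc (j - i)"] ends by (simp add: n_def)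
    ultimately have opp: "M $ k $ d j = - M $ k $ d i" using sk[of k "d j"] by simp
    have "(\<Prod>t<n. - (g (e t) \<bullet> g (e (Suc t mod n)))) =
        - (g k \<bullet> g (d i)) * (\<Prod>t<j - i. - (g (e (Suc t)) \<bullet> g (e (Suc (Suc t) mod n)))) * - (g (d j) \<bullet> g k)"
      unfolding n_def prod_lessThan_ends by (simp add: ends)
    also have "(\<Prod>t<j - i. - (g (e (Suc t)) \<bullet> g (e (Suc (Suc t) mod n)))) = (\<Prod>t<j - i. f (i + t))"
      by (intro prod.cong) (auto simp: e_def f_def n_def)
    finally have fr: "(g k \<bullet> g (d i)) * (g k \<bullet> g (d j)) * (\<Prod>t<j - i. f (i + t)) = -1"
      using chordless_cycle_frustrated[OF g M ch] by (simp add: inner_commute mult_ac)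
    have "M $ k $ d i * M $ k $ d j = -1"
    proof -
      have "\<bar>M $ k $ d i\<bar> = 1"
        using companion_family_entry_le[OF g M, of k "d i"] nbi unfolding nb_def by linarith
      then show ?thesis using opp by (auto simp: abs_if split: if_splits)
    qed
    then have "real_of_int (M $ k $ d i) * real_of_int (M $ k $ d j) = -1"
      by (metis of_int_1 of_int_minus of_int_mult)
    moreover have "\<delta> i * \<delta> j * (\<Prod>t<j - i. f (i + t)) =
       (real_of_int (M $ k $ d i) * real_of_int (M $ k $ d j)) *
       ((g k \<bullet> g (d i)) * (g k \<bullet> g (d j)) * (\<Prod>t<j - i. f (i + t)))"
      by (simp add: \<delta>_def mult_ac)
    ultimately show ?thesis using fr by simp
  qed
  have walk: "\<delta> j * (\<Prod>t<j. f t) = \<delta> 0" if "j \<le> m" "nb j" for j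
    using that
  proof (induction j rule: less_induct)
    case (less j)
    show ?case
    proof (cases "j = 0")
      case True then show ?thesis by simp
    next
      case False
      \<comment> \<open>The previous neighbour of \<open>k\<close> along the walk.\<close>
      define i where "i = Max {t. t < j \<and> nb t}"
      have "nb 0" using nb0 m by (simp add: nb_def dc)
      then have ne: "{t. t < j \<and> nb t} \<noteq> {}" using False by auto
      have fin: "finite {t. t < j \<and> nb t}" by simp
      have i: "i < j" "nb i" using Max_in[OF fin ne] by (auto simp: i_def)
      have "\<not> nb t" if t: "i < t" "t < j" for t
      proof
        assume "nb t"
        then have "t \<le> i" unfolding i_def using fin t(2) by (intro Max_ge) auto
        then show False using t(1) by simp
      qed
      from arc[OF i(1) less.prems(1) i(2) less.prems(2) this]
      have a: "\<delta> i * \<delta> j * (\<Prod>t<j - i. f (i + t)) = 1" by blast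
      have "(\<Prod>t<j. f t) = (\<Prod>t<i. f t) * (\<Prod>t<j - i. f (i + t))"
        using prod_lessThan_add[of f i "j - i"] i by simp
      then have "\<delta> j * (\<Prod>t<j. f t) = \<delta> j * (\<Prod>t<j - i. f (i + t)) * (\<Prod>t<i. f t)"
        by (simp add: mult_ac)
      also have "\<delta> j * (\<Prod>t<j - i. f (i + t)) = \<delta> i"
      proof -
        have "\<delta> i * (\<delta> i * \<delta> j * (\<Prod>t<j - i. f (i + t))) = \<delta> i" using a by simp
        then show ?thesis using \<delta>[OF i(2)] by (metis mult.assoc mult_1)
      qed
      also have "\<delta> i * (\<Prod>t<i. f t) = \<delta> 0"
        using less.IH[OF i(1)] less.prems i by simp
      finally show ?thesis .
    qed
  qed
  have "nb m" using nb0 by (simp add: nb_def dm)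
  have "(\<Prod>t<m. f t) = (\<Prod>t<m. - (g (c t) \<bullet> g (c (Suc t mod m))))"
    by (intro prod.cong) (auto simp: f_def d_def)
  then have "(\<Prod>t<m. f t) = -1" using chordless_cycle_frustrated[OF g M c] by simp
  with walk[OF _ \<open>nb m\<close>] have "- \<delta> m = \<delta> 0" by simp
  moreover have "\<delta> m = \<delta> 0" by (simp add: \<delta>_def d_def)
  ultimately have "\<delta> m = 0" by simp
  then show False using \<delta>[OF \<open>nb m\<close>] by simp
qed

text \<open>When \<open>k\<close> is joined to exactly the ends of one edge, the oriented triangle formed by them loses that
  edge under mutation at \<open>k\<close>.  In \<open>B\<close> the vertex \<open>k\<close> is therefore inserted into the cycle, and the
  orientation of this longer chordless cycle passes to the given one.\<close>

lemma oriented_cycle_beside_edge: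
  assumes g: "companion_family B g" and B: "skew_symmetric B" and O: "all_cycles_oriented B"
    and c: "chordless_cycle (mutate k B) m c" and k: "k \<notin> c ` {..<m}"
    and nb: "\<And>i. i < m \<Longrightarrow> mutate k B $ k $ c i \<noteq> 0 \<longleftrightarrow> i = m - 1 \<or> i = 0"
  shows "oriented_cycle (mutate k B) m c"
proof -
  define M where "M = mutate k B"
  have BM: "B = mutate k M" by (simp add: M_def mutate_involutive)
  have M: "skew_symmetric M" unfolding M_def by (rule skew_symmetric_mutate[OF B])
  note s = skew_symmetric_entry[OF M]
  have le: "\<bar>M$x$y\<bar> \<le> 1" for x y
    using companion_family_entry_le[OF companion_family_mutate[OF g B O] M[unfolded M_def]]
    by (simp add: M_def)
  note c = c[folded M_def] and nb = nb[folded M_def]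
  note m = chordless_cycleD(1)[OF c] and inj = chordless_cycleD(2)[OF c]
    and adj = chordless_cycleD(3)[OF c]
  have ck: "c i \<noteq> k" if "i < m" for i using k that by auto
  let ?T = "\<lambda>i::nat. if i = 0 then k else if i = 1 then c (m - 1) else c 0"
  have "M $ c 0 $ k \<noteq> 0" using nb[of 0] s[of k "c 0"] m by auto
  then have T: "chordless_cycle M 3 ?T"
    using chordless_triangle[OF M, of k "c (m - 1)" "c 0"] nb[of "m - 1"] adj[of "m - 1" 0] m by auto
  have "oriented_cycle M 3 ?T"
    using oriented_cycle_through_start[OF g B O T[unfolded M_def]] by (simp add: M_def)
  then obtain f where "\<And>i. i < 3 \<Longrightarrow> M $ ?T i $ ?T (Suc i mod 3) = f"
    unfolding oriented_cycle_def by metis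
  from this[of 0] this[of 1] this[of 2]
  have f: "M $ k $ c (m - 1) = f" "M $ c (m - 1) $ c 0 = f" "M $ c 0 $ k = f" by simp_all
  have f1: "f = 1 \<or> f = -1" using nb[of "m - 1"] le[of k "c (m - 1)"] m f by auto
  have Mk: "M $ c i $ k = (if i = 0 then f else if i = m - 1 then - f else 0)" if i: "i < m" for i
  proof -
    have "M $ c (m - 1) $ k = - f" using s[of "c (m - 1)" k] f(1) by linarith
    moreover have "M $ c i $ k = 0" if "i \<noteq> 0" "i \<noteq> m - 1"
      using nb[OF i] that s[of "c i" k] by linarith
    ultimately show ?thesis using f(3) by simp
  qed
  have kM: "M $ k $ c i = - M $ c i $ k" for i by (rule s)
  have eq: "B $ c i $ c j = M $ c i $ c j + (if i = m - 1 \<and> j = 0 then - f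
      else if i = 0 \<and> j = m - 1 then f else 0)" if "i < m" "j < m" for i j
    unfolding BM mutate_entry using that f1 m by (auto simp: ck kM Mk)
  have Bk: "B $ c i $ k = (if i = 0 then - f else if i = m - 1 then f else 0)" if "i < m" for i
    using Mk[OF that] unfolding BM mutate_entry by auto
  have kB: "B $ k $ c i = - B $ c i $ k" for i by (rule skew_symmetric_entry[OF B])
  have M0: "M $ c 0 $ c (m - 1) = - f" using s[of "c 0" "c (m - 1)"] f(2) by linarith
  define d where "d i = (if i = m then k else c i)" for i
  have "chordless_cycle B (Suc m) d"
    unfolding chordless_cycle_def
  proof (intro conjI allI impI)
    show "3 \<le> Suc m" using m by simp
    have "inj_on d {..<m}" using inj by (auto simp: inj_on_def d_def)
    moreover have "d m \<notin> d ` {..<m}" using k by (auto simp: d_def)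
    ultimately show "inj_on d {..<Suc m}" by (simp add: lessThan_Suc)
    fix i j assume ij: "i < Suc m" "j < Suc m"
    consider "i = m" "j = m" | "i = m" "j < m" | "i < m" "j = m" | "i < m" "j < m" using ij by linarith
    then show "B $ d i $ d j \<noteq> 0 \<longleftrightarrow> j = Suc i mod Suc m \<or> i = Suc j mod Suc m"
    proof cases
      case 1
      then show ?thesis using m skew_symmetric_diag[OF B] by (simp add: d_def)
    next
      case 2
      then show ?thesis using m f1 by (auto simp: d_def kB Bk)
    next
      case 3
      then show ?thesis using m f1 by (auto simp: d_def Bk)
    next
      case 4
      have "B $ c i $ c j \<noteq> 0 \<longleftrightarrow> j = Suc i \<or> i = Suc j"
      proof (cases "i = m - 1 \<and> j = 0 \<or> i = 0 \<and> j = m - 1")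
        case True
        then show ?thesis using eq[OF 4] f(2) M0 m by auto
      next
        case False
        then have "B $ c i $ c j = M $ c i $ c j" using eq[OF 4] by auto
        then show ?thesis using adj[OF 4] False 4 by (auto simp: Suc_mod_less split: if_splits)
      qed
      then show ?thesis using 4 by (simp add: d_def)
    qed
  qed
  from all_cycles_orientedE[OF O this]
  obtain e where e: "\<And>i. i < Suc m \<Longrightarrow> B $ d i $ d (Suc i mod Suc m) = e" by metis
  have "Suc (m - 1) = m" "m - 1 \<noteq> m" "m - 1 \<noteq> 0" using m by auto
  then have "e = f" using e[of "m - 1"] Bk[of "m - 1"] by (simp add: d_def)
  have "M $ c i $ c (Suc i mod m) = f" if "i < m" for i
  proof (cases "Suc i = m")
    case True
    then have "i = m - 1" by simp
    then show ?thesis using f m by simp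
  next
    case False
    then show ?thesis using e[of i] eq[of i "Suc i"] that m \<open>e = f\<close> by (simp add: d_def split: if_splits)
  qed
  then show ?thesis unfolding M_def oriented_cycle_def by blast
qed

text \<open>A cycle through \<open>k\<close> may be rotated to start there.  A cycle avoiding \<open>k\<close> is unchanged unless it
  has arrows both from and to \<open>k\<close>.  In that case \<open>k\<close> has two neighbours on it, so these are the ends of
  one edge, and rotating makes that edge the closing one.\<close>

lemma all_cycles_oriented_mutate:
  assumes g: "companion_family B g" and B: "skew_symmetric B" and O: "all_cycles_oriented B"
  shows "all_cycles_oriented (mutate k B)"
  unfolding all_cycles_oriented_def
proof (intro allI impI)
  fix m c assume c: "chordless_cycle (mutate k B) m c"
  define M where "M = mutate k B"
  have BM: "B = mutate k M" by (simp add: M_def mutate_involutive)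
  have M: "skew_symmetric M" unfolding M_def by (rule skew_symmetric_mutate[OF B])
  have gM: "companion_family M (mutate_inward B k g)"
    unfolding M_def by (rule companion_family_mutate[OF g B O])
  have s: "M $ k $ y = - M $ y $ k" for y by (rule skew_symmetric_entry[OF M])
  have through: "oriented_cycle M n d" if "chordless_cycle M n d" "d 0 = k" for n d
    using oriented_cycle_through_start[OF g B O] that by (simp add: M_def)
  note c = c[folded M_def]
  have "oriented_cycle M m c"
  proof (cases "k \<in> c ` {..<m}")
    case True
    then obtain j where "j < m" "c j = k" by auto
    with c through show ?thesis by (metis oriented_cycle_start_at)
  next
    case k: False
    show ?thesis
    proof (cases "\<exists>i<m. \<exists>j<m. M $ c i $ k > 0 \<and> M $ k $ c j > 0")
      case False
      have eq: "B $ c i $ c j = M $ c i $ c j" if "i < m" "j < m" for i j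
      proof -
        have "\<not> (M $ c i $ k > 0 \<and> M $ k $ c j > 0)" "\<not> (M $ c j $ k > 0 \<and> M $ k $ c i > 0)"
          using False that by blast+
        moreover have "c i \<noteq> k" "c j \<noteq> k" using k that by auto
        ultimately show ?thesis unfolding BM mutate_entry by (auto simp: s)
      qed
      then have "chordless_cycle B m c" using c by (simp add: chordless_cycle_def)
      then have "oriented_cycle B m c" using O by (simp add: all_cycles_oriented_def)
      then show ?thesis using eq c by (auto simp: oriented_cycle_def chordless_cycle_def)
    next
      case True
      then obtain i0 j0 where ij: "i0 < m" "j0 < m" "M $ c i0 $ k > 0" "M $ k $ c j0 > 0" by blast
      show ?thesis
      proof (rule oriented_cycle_start_at[OF c ij(2)])
        fix d assume d: "chordless_cycle M m d" "d 0 = c j0" "d ` {..<m} = c ` {..<m}"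
        have "c i0 \<in> d ` {..<m}" using d ij by auto
        then obtain r where r: "r < m" "d r = c i0" by auto
        have "c i0 \<noteq> c j0" using ij s[of "c j0"] by auto
        then have "r \<noteq> 0" using r(2) d(2) by metis
        have nb: "M $ k $ d 0 \<noteq> 0" "M $ k $ d r \<noteq> 0"
          using r(2) d(2) ij(3,4) s[of "c i0"] by simp_all
        have kd: "k \<notin> d ` {..<m}" using k d by simp
        have "0 < r" using \<open>r \<noteq> 0\<close> by simp
        from outside_neighbours_consecutive[OF gM M d(1) kd through nb(1) this r(1) nb(2)]
        obtain t where t: "t < m" "\<And>i. i < m \<Longrightarrow> M $ k $ d i \<noteq> 0 \<longleftrightarrow> i = t \<or> i = Suc t mod m"
          by blast
        show "oriented_cycle M m d"
        proof (rule oriented_cycle_start_at[OF d(1), of "Suc t mod m"])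
          fix e assume e: "chordless_cycle M m e" "e 0 = d (Suc t mod m)" "e ` {..<m} = d ` {..<m}"
            "\<And>i. i < m \<Longrightarrow> e i = d ((i + Suc t mod m) mod m)"
          have "(m - 1 + Suc t mod m) mod m = (m - 1 + Suc t) mod m" by (rule mod_add_right_eq)
          also have "\<dots> = t" using t by simp
          finally have em: "e (m - 1) = d t" using e(4)[of "m - 1"] t by simp
          have inj: "inj_on e {..<m}" "inj_on d {..<m}" using e(1) d(1) by (auto simp: chordless_cycle_def)
          have "M $ k $ e i \<noteq> 0 \<longleftrightarrow> i = m - 1 \<or> i = 0" if i: "i < m" for i
          proof -
            have "e i \<in> d ` {..<m}" using i e(3) by auto
            then obtain j where j: "j < m" "e i = d j" by auto
            have "M $ k $ e i \<noteq> 0 \<longleftrightarrow> j = t \<or> j = Suc t mod m" using t(2)[OF j(1)] j by simp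
            also have "\<dots> \<longleftrightarrow> d j = d t \<or> d j = d (Suc t mod m)"
              using inj(2) j t by (auto simp: inj_on_def)
            also have "\<dots> \<longleftrightarrow> e i = e (m - 1) \<or> e i = e 0" using j em e(2) by simp
            also have "\<dots> \<longleftrightarrow> i = m - 1 \<or> i = 0"
              using i by (simp add: inj_on_eq_iff[OF inj(1)])
            finally show ?thesis .
          qed
          moreover have "k \<notin> e ` {..<m}" using kd e by simp
          ultimately show "oriented_cycle M m e"
            using oriented_cycle_beside_edge[OF g B O] e(1) by (simp add: M_def)
        qed (use t in simp)
      qed
    qed
  qed
  then show "oriented_cycle (mutate k B) m c" by (simp add: M_def)
qed

section \<open>The orientation of cycles in Dynkin type\<close>

text \<open>All factors of the frustration product would be 1.  This applies to simple roots and replaces an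
  inspection of the Dynkin diagrams, all of which are trees.\<close>

lemma companion_family_nonpos_acyclic:
  assumes g: "companion_family B g" and B: "skew_symmetric B"
    and neg: "\<And>x y. x \<noteq> y \<Longrightarrow> g x \<bullet> g y \<le> 0"
  shows "\<not> chordless_cycle B m c"
proof
  assume c: "chordless_cycle B m c"
  have "- (g (c i) \<bullet> g (c (Suc i mod m))) = 1" if i: "i < m" for i
  proof -
    have nz: "B $ c i $ c (Suc i mod m) \<noteq> 0"
      using chordless_cycleD(3)[OF c, of i "Suc i mod m"] i by simp
    then have "c i \<noteq> c (Suc i mod m)" using skew_symmetric_diag[OF B] by metis
    then show ?thesis using companion_family_edge(1)[OF g B nz] neg by fastforce
  qed
  then have "(\<Prod>i<m. - (g (c i) \<bullet> g (c (Suc i mod m)))) = 1" by (intro prod.neutral) simp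
  then show False using chordless_cycle_frustrated[OF g B c] by simp
qed

lemma companion_family_simple_roots:
  fixes B0 :: "int^'i^'i" and \<alpha> :: "nat \<Rightarrow> 'v::euclidean_space"
  assumes norm: "\<And>\<beta>. \<beta> \<in> \<Phi> \<Longrightarrow> \<beta> \<bullet> \<beta> = 2"
    and simple: "simple_system \<Phi> (dynkin_vertices \<Delta>) \<alpha>"
    and cartan: "\<forall>i\<in>dynkin_vertices \<Delta>. \<forall>j\<in>dynkin_vertices \<Delta>.
          2 * (\<alpha> i \<bullet> \<alpha> j) / (\<alpha> j \<bullet> \<alpha> j) = real_of_int (cartan_matrix \<Delta> i j)"
    and \<sigma>: "bij_betw \<sigma> (UNIV :: 'i set) (dynkin_vertices \<Delta>)"
    and B0: "\<forall>x y. cartan_counterpart B0 $ x $ y = cartan_matrix \<Delta> (\<sigma> x) (\<sigma> y)"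
  shows "companion_family B0 (\<alpha> \<circ> \<sigma>)" "x \<noteq> y \<Longrightarrow> (\<alpha> \<circ> \<sigma>) x \<bullet> (\<alpha> \<circ> \<sigma>) y \<le> 0"
proof -
  let ?I = "dynkin_vertices \<Delta>"
  have \<sigma>I: "\<sigma> x \<in> ?I" for x using \<sigma> by (auto simp: bij_betw_def)
  have inj: "inj (\<alpha> \<circ> \<sigma>)" using \<sigma> simple
    by (intro comp_inj_on) (auto simp: bij_betw_def simple_system_def)
  have n2: "(\<alpha> \<circ> \<sigma>) x \<bullet> (\<alpha> \<circ> \<sigma>) x = 2" for x
    using simple \<sigma>I by (auto simp: simple_system_def intro!: norm)
  have inner: "(\<alpha> \<circ> \<sigma>) x \<bullet> (\<alpha> \<circ> \<sigma>) y = - real_of_int \<bar>B0$x$y\<bar>" if "x \<noteq> y" for x y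
  proof -
    have "2 * (\<alpha> (\<sigma> x) \<bullet> \<alpha> (\<sigma> y)) / (\<alpha> (\<sigma> y) \<bullet> \<alpha> (\<sigma> y)) = real_of_int (cartan_matrix \<Delta> (\<sigma> x) (\<sigma> y))"
      using cartan \<sigma>I by blast
    also have "cartan_matrix \<Delta> (\<sigma> x) (\<sigma> y) = - \<bar>B0$x$y\<bar>"
      using B0[rule_format, of x y] that by (simp add: cartan_counterpart_def)
    finally show ?thesis using n2[of y] by simp
  qed
  then show "x \<noteq> y \<Longrightarrow> (\<alpha> \<circ> \<sigma>) x \<bullet> (\<alpha> \<circ> \<sigma>) y \<le> 0" by simp
  show "companion_family B0 (\<alpha> \<circ> \<sigma>)"
    unfolding companion_family_def
  proof (intro conjI allI impI)
    show "\<bar>(\<alpha> \<circ> \<sigma>) x \<bullet> (\<alpha> \<circ> \<sigma>) y\<bar> = real_of_int \<bar>B0$x$y\<bar>" if "x \<noteq> y" for x y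
      using inner[OF that] by simp
    fix h x assume h: "(\<Sum>x\<in>UNIV. h x *\<^sub>R (\<alpha> \<circ> \<sigma>) x) = 0"
    define G where "G = \<alpha> \<circ> \<sigma>"
    have injG: "inj G" using inj by (simp add: G_def)
    have "(\<Sum>v\<in>range G. h (inv G v) *\<^sub>R v) = (\<Sum>x\<in>UNIV. h x *\<^sub>R G x)"
      by (subst sum.reindex[OF injG]) (simp add: inv_f_f[OF injG] comp_def)
    also have "\<dots> = 0" using h by (simp only: G_def)
    finally have "(\<Sum>v\<in>range G. h (inv G v) *\<^sub>R v) = 0" .
    moreover have "range G \<subseteq> \<alpha> ` ?I" using \<sigma>I by (auto simp: G_def)
    moreover have "independent (\<alpha> ` ?I)" using simple by (simp add: simple_system_def)
    ultimately have "h (inv G (G x)) = 0"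
      by (intro independentD[of "\<alpha> ` ?I" "range G" "\<lambda>v. h (inv G v)" "G x"]) auto
    then show "h x = 0" unfolding inv_f_f[OF injG] .
  qed (rule n2)
qed

text \<open>Mutations are involutions, so the invariant is carried backwards along the mutation sequence from
  the Dynkin quiver \<open>B0\<close> to \<open>B\<close>, together with some companion family.  The latter is
  needed at each step and need not be the companion basis of the theorem.\<close>

lemma exchange_matrix_cycles_oriented:
  fixes B :: "int^'i^'i" and \<Phi> :: "'v::euclidean_space set"
  assumes B: "exchange_matrix_of_type \<Delta> B" and \<Phi>: "root_system_of_type \<Delta> \<Phi>"
    and norm: "\<And>\<beta>. \<beta> \<in> \<Phi> \<Longrightarrow> \<beta> \<bullet> \<beta> = 2"
  shows "all_cycles_oriented B"
proof -
  obtain B0 \<sigma> where B0: "(\<lambda>B B'. \<exists>k. B' = mutate k B)\<^sup>*\<^sup>* B B0"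
      "bij_betw \<sigma> (UNIV :: 'i set) (dynkin_vertices \<Delta>)"
      "\<forall>x y. cartan_counterpart B0 $ x $ y = cartan_matrix \<Delta> (\<sigma> x) (\<sigma> y)"
    and skew: "skew_symmetric B"
    using B by (auto simp: exchange_matrix_of_type_def mutation_equivalent_def)
  obtain \<alpha> where \<alpha>: "simple_system \<Phi> (dynkin_vertices \<Delta>) \<alpha>"
      "\<forall>i\<in>dynkin_vertices \<Delta>. \<forall>j\<in>dynkin_vertices \<Delta>.
          2 * (\<alpha> i \<bullet> \<alpha> j) / (\<alpha> j \<bullet> \<alpha> j) = real_of_int (cartan_matrix \<Delta> i j)"
    using \<Phi> by (auto simp: root_system_of_type_def)
  note roots = companion_family_simple_roots[OF norm \<alpha> B0(2,3)]
  have "skew_symmetric B \<Longrightarrow> all_cycles_oriented B \<and> (\<exists>g :: 'i \<Rightarrow> 'v. companion_family B g)"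
    using B0(1)
  proof (induction rule: converse_rtranclp_induct)
    case base
    have "\<not> chordless_cycle B0 m c" for m c
      using companion_family_nonpos_acyclic[OF roots(1) base roots(2)] by blast
    then show ?case using roots(1) by (auto simp: all_cycles_oriented_def)
  next
    case (step B B')
    then obtain k where k: "B' = mutate k B" by blast
    have B': "skew_symmetric B'" unfolding k by (rule skew_symmetric_mutate[OF step.prems])
    have eq: "B = mutate k B'" unfolding k by (rule mutate_involutive[symmetric])
    obtain g :: "'i \<Rightarrow> 'v" where "companion_family B' g" "all_cycles_oriented B'"
      using step.IH B' by blast
    then show ?case
      unfolding eq using all_cycles_oriented_mutate companion_family_mutate B' by blast
  qed
  then show ?thesis using skew by blast
qed

section \<open>Companion bases\<close>

text \<open>The quadratic form of a Gram matrix is a squared length; so positive definiteness amounts to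
  linear independence.\<close>

lemma quadratic_form_Gram:
  fixes A :: "int^'i^'i" and \<gamma> :: "'i \<Rightarrow> 'v::real_inner"
  assumes A: "\<forall>x y. real_of_int (A$x$y) = \<gamma> x \<bullet> \<gamma> y"
  shows "v \<bullet> (map_matrix real_of_int A *v v) =
    (\<Sum>x\<in>UNIV. v$x *\<^sub>R \<gamma> x) \<bullet> (\<Sum>x\<in>UNIV. v$x *\<^sub>R \<gamma> x)"
proof -
  have "real_of_int (A$x$y) = \<gamma> y \<bullet> \<gamma> x" for x y using A by (simp add: inner_commute)
  then show ?thesis
    by (simp add: inner_vec_def matrix_vector_mult_def map_matrix_def inner_sum_left inner_sum_right
        sum_distrib_left mult_ac)
qed

lemma companion_family_of_basis:
  fixes B :: "int^'i^'i"
  assumes "companion_basis \<Phi> B \<gamma>"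
  shows "companion_family B \<gamma>"
proof -
  obtain A :: "int^'i^'i" where A: "\<forall>x y. real_of_int (A$x$y) = \<gamma> x \<bullet> \<gamma> y"
    and comp: "quasi_cartan_companion A B" and pos: "positive_definite A"
    using assms by (auto simp: companion_basis_def)
  show ?thesis
    unfolding companion_family_def
  proof (intro conjI allI impI)
    show "\<gamma> x \<bullet> \<gamma> x = 2" for x
      using A comp unfolding quasi_cartan_companion_def by (metis of_int_numeral)
    show "\<bar>\<gamma> x \<bullet> \<gamma> y\<bar> = real_of_int \<bar>B$x$y\<bar>" if "x \<noteq> y" for x y
      using A comp that unfolding quasi_cartan_companion_def by (metis of_int_abs)
    fix h x assume h: "(\<Sum>x\<in>UNIV. h x *\<^sub>R \<gamma> x) = 0"
    have "(\<chi> x. h x) \<bullet> (map_matrix real_of_int A *v (\<chi> x. h x)) = 0"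
      unfolding quadratic_form_Gram[OF A] by (simp add: h)
    then have "(\<chi> x. h x) = (0 :: real^'i)" using pos unfolding positive_definite_def by force
    then show "h x = 0" by (metis vec_lambda_beta zero_index)
  qed
qed

lemma companion_basisI:
  fixes B :: "int^'i^'i" and \<gamma> :: "'i \<Rightarrow> 'v::euclidean_space"
  assumes g: "companion_family B \<gamma>" and \<Phi>: "range \<gamma> \<subseteq> \<Phi>"
    and span: "int_module.span (range \<gamma>) = int_module.span \<Phi>"
  shows "companion_basis \<Phi> B \<gamma>"
proof -
  have inj: "inj \<gamma>"
  proof (rule injI, rule ccontr)
    fix x y assume xy: "\<gamma> x = \<gamma> y" "x \<noteq> y"
    then have "(\<Sum>z\<in>{x, y}. (if z = x then 1 else -1) *\<^sub>R \<gamma> (id z)) = 0" by simp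
    from companion_family_indep_on[OF g _ _ this, of x] show False by auto
  qed
  define A :: "int^'i^'i" where "A = (\<chi> x y. \<lfloor>\<gamma> x \<bullet> \<gamma> y\<rfloor>)"
  have A: "\<forall>x y. real_of_int (A$x$y) = \<gamma> x \<bullet> \<gamma> y"
  proof (intro allI)
    fix x y
    have "\<gamma> x \<bullet> \<gamma> y \<in> \<int>"
    proof (cases "x = y")
      case True then show ?thesis by (simp add: companion_family_norm[OF g])
    next
      case False
      from companion_family_inner[OF g this] have "\<bar>\<gamma> x \<bullet> \<gamma> y\<bar> \<in> \<int>" by simp
      then show ?thesis by (auto simp: abs_if split: if_splits)
    qed
    then show "real_of_int (A$x$y) = \<gamma> x \<bullet> \<gamma> y" by (simp add: A_def)
  qed
  have "quasi_cartan_companion A B"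
    unfolding quasi_cartan_companion_def
  proof (intro conjI allI impI)
    show "transpose A = A" by (simp add: A_def transpose_def inner_commute)
    show "A$x$x = 2" for x by (simp add: A_def companion_family_norm[OF g])
    show "\<bar>A$x$y\<bar> = \<bar>B$x$y\<bar>" if "x \<noteq> y" for x y
      using companion_family_inner[OF g that] A by (metis of_int_abs of_int_eq_iff)
  qed
  moreover have "positive_definite A"
    unfolding positive_definite_def
  proof (intro allI impI)
    fix v :: "real^'i" assume "v \<noteq> 0"
    then have "(\<Sum>x\<in>UNIV. v$x *\<^sub>R \<gamma> x) \<noteq> 0"
      using companion_family_indep[OF g, of "\<lambda>x. v$x"] by (auto simp: vec_eq_iff)
    then show "v \<bullet> (map_matrix real_of_int A *v v) > 0"
      unfolding quadratic_form_Gram[OF A] by simp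
  qed
  moreover have "int_module.independent (range \<gamma>)"
    unfolding int_module.dependent_explicit
  proof clarify
    fix t :: "'v set" and u v
    assume t: "finite t" "t \<subseteq> range \<gamma>" and 0: "(\<Sum>v\<in>t. real_of_int (u v) *\<^sub>R v) = 0"
      and v: "v \<in> t" "u v \<noteq> 0"
    have t': "t = \<gamma> ` (\<gamma> -` t)" using t by auto
    have "(\<Sum>x\<in>\<gamma> -` t. real_of_int (u (\<gamma> x)) *\<^sub>R \<gamma> (id x)) = (\<Sum>v\<in>t. real_of_int (u v) *\<^sub>R v)"
      by (subst (2) t', subst sum.reindex) (auto intro: inj_on_subset[OF inj])
    moreover obtain x where "v = \<gamma> x" using t v by auto
    ultimately have "real_of_int (u (\<gamma> x)) = 0"
      using companion_family_indep_on[OF g, of id "\<gamma> -` t" "\<lambda>x. real_of_int (u (\<gamma> x))" x] 0 v by simp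
    then show False using v \<open>v = \<gamma> x\<close> by simp
  qed
  ultimately show ?thesis using inj \<Phi> span A unfolding companion_basis_def by blast
qed

lemma int_span_shear:
  fixes g g' :: "'i \<Rightarrow> 'v::real_vector"
  assumes "\<And>x. \<exists>n::int. g' x = g x + real_of_int n *\<^sub>R g k" and "g' k = g k"
  shows "int_module.span (range g') = int_module.span (range g)"
proof -
  have sub: "range a \<subseteq> int_module.span (range b)"
    if ab: "\<And>x. \<exists>n::int. a x = b x + real_of_int n *\<^sub>R b k" for a b :: "'i \<Rightarrow> 'v"
  proof clarify
    fix x
    obtain n :: int where "a x = b x + real_of_int n *\<^sub>R b k" using ab by blast
    moreover have "b x + real_of_int n *\<^sub>R b k \<in> int_module.span (range b)"
      by (intro int_module.span_add int_module.span_scale int_module.span_base rangeI)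
    ultimately show "a x \<in> int_module.span (range b)" by simp
  qed
  have "\<exists>n::int. g x = g' x + real_of_int n *\<^sub>R g' k" for x
  proof -
    obtain n :: int where "g' x = g x + real_of_int n *\<^sub>R g k" using assms(1) by blast
    then have "g x = g' x + real_of_int (- n) *\<^sub>R g' k" using assms(2) by simp
    then show ?thesis by blast
  qed
  then show ?thesis using sub[of g' g] sub[of g g'] assms(1) by (simp add: int_module.span_eq)
qed

lemma companion_basis_mutate_inward:
  fixes B :: "int^'i^'i"
  assumes \<Phi>: "root_system \<Phi>" and norm: "\<And>\<alpha>. \<alpha> \<in> \<Phi> \<Longrightarrow> \<alpha> \<bullet> \<alpha> = 2"
    and B: "skew_symmetric B" and O: "all_cycles_oriented B"
    and \<gamma>: "companion_basis \<Phi> B \<gamma>"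
  shows "companion_basis \<Phi> (mutate k B) (mutate_inward B k \<gamma>)"
proof (rule companion_basisI)
  let ?g = "mutate_inward B k \<gamma>"
  have g: "companion_family B \<gamma>" using \<gamma> by (rule companion_family_of_basis)
  show "companion_family (mutate k B) ?g" by (rule companion_family_mutate[OF g B O])
  have \<gamma>\<Phi>: "\<gamma> x \<in> \<Phi>" for x using \<gamma> by (auto simp: companion_basis_def)
  have "refl_root (\<gamma> k) (\<gamma> x) \<in> \<Phi>" for x
  proof -
    have "\<forall>\<alpha>\<in>\<Phi>. \<forall>\<beta>\<in>\<Phi>. \<beta> - (2 * (\<beta> \<bullet> \<alpha>) / (\<alpha> \<bullet> \<alpha>)) *\<^sub>R \<alpha> \<in> \<Phi>"
      using \<Phi> unfolding root_system_def by (elim conjE)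
    from bspec[OF bspec[OF this \<gamma>\<Phi>[of k]] \<gamma>\<Phi>[of x]]
    have "\<gamma> x - (2 * (\<gamma> x \<bullet> \<gamma> k) / (\<gamma> k \<bullet> \<gamma> k)) *\<^sub>R \<gamma> k \<in> \<Phi>" .
    then show ?thesis using norm[OF \<gamma>\<Phi>[of k]] by (simp add: refl_root_def)
  qed
  then show "range ?g \<subseteq> \<Phi>" using \<gamma>\<Phi> by (auto simp: mutate_inward_def)
  have "int_module.span (range ?g) = int_module.span (range \<gamma>)"
  proof (rule int_span_shear)
    show "?g k = \<gamma> k" using skew_symmetric_diag[OF B] by (simp add: mutate_inward_shear)
    obtain A :: "int^'i^'i" where A: "\<forall>x y. real_of_int (A$x$y) = \<gamma> x \<bullet> \<gamma> y"
      using \<gamma> by (auto simp: companion_basis_def)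
    have "?g x = \<gamma> x + real_of_int (if B$x$k > 0 then - A$x$k else 0) *\<^sub>R \<gamma> k" for x
      by (simp add: mutate_inward_shear A)
    then show "\<exists>n::int. ?g x = \<gamma> x + real_of_int n *\<^sub>R \<gamma> k" for x by blast
  qed
  then show "int_module.span (range ?g) = int_module.span \<Phi>"
    using \<gamma> by (simp add: companion_basis_def)
qed

lemma quasi_cartan_companion_uminus: "quasi_cartan_companion A (- B) = quasi_cartan_companion A B"
  by (simp add: quasi_cartan_companion_def)

lemma companion_basis_uminus: "companion_basis \<Phi> (- B) \<gamma> = companion_basis \<Phi> B \<gamma>"
  by (simp add: companion_basis_def quasi_cartan_companion_uminus)

lemma all_cycles_oriented_uminus:
  "all_cycles_oriented B \<Longrightarrow> all_cycles_oriented (- B)"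
  unfolding all_cycles_oriented_def oriented_cycle_def chordless_cycle_def
  by (simp, metis)

lemma mutate_outward_inward:
  assumes "skew_symmetric B" shows "mutate_outward B k \<gamma> = mutate_inward (- B) k \<gamma>"
proof
  fix x
  have "B$k$x = - B$x$k" by (rule skew_symmetric_entry[OF assms])
  then show "mutate_outward B k \<gamma> x = mutate_inward (- B) k \<gamma> x"
    by (simp add: mutate_outward_def mutate_inward_def quiver_def)
qed

theorem theorem6p1:
  fixes \<Delta> :: dynkin
    and \<Phi> :: "'v::euclidean_space set"
    and B :: "int^'i^'i"
    and \<gamma> :: "'i \<Rightarrow> 'v"
    and k :: 'i
  assumes "dynkin_ok \<Delta>"
    and "exchange_matrix_of_type \<Delta> B"
    and "root_system_of_type \<Delta> \<Phi>"
    and "\<And>\<alpha>. \<alpha> \<in> \<Phi> \<Longrightarrow> \<alpha> \<bullet> \<alpha> = 2"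
    and "companion_basis \<Phi> B \<gamma>"
  shows "companion_basis \<Phi> (mutate k B) (mutate_inward B k \<gamma>)
    \<and> companion_basis \<Phi> (mutate k B) (mutate_outward B k \<gamma>)"
proof
  have B: "skew_symmetric B" using assms(2) by (simp add: exchange_matrix_of_type_def)
  have \<Phi>: "root_system \<Phi>" using assms(3) by (simp add: root_system_of_type_def)
  have O: "all_cycles_oriented B" by (rule exchange_matrix_cycles_oriented[OF assms(2-4)])
  show "companion_basis \<Phi> (mutate k B) (mutate_inward B k \<gamma>)"
    by (rule companion_basis_mutate_inward[OF \<Phi> assms(4) B O assms(5)])
  have "companion_basis \<Phi> (mutate k (- B)) (mutate_inward (- B) k \<gamma>)"
    using companion_basis_mutate_inward[OF \<Phi> assms(4) skew_symmetric_uminus[OF B]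
        all_cycles_oriented_uminus[OF O]] assms(5) by (simp add: companion_basis_uminus)
  then show "companion_basis \<Phi> (mutate k B) (mutate_outward B k \<gamma>)"
    by (simp add: mutate_uminus companion_basis_uminus mutate_outward_inward[OF B])
qed

end
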